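(* Let $\mathcal{D}$ be a probability distribution on $[n]=\{1,\dots,n\}$ with full support, let $\mathcal{D}_{\min}=\min_{x\in[n]}\mathcal{D}(x)$, and let $\mathcal{Q}$ be a pair distribution on $[n]$ whose induced graph $G_{\mathcal{Q}}$ is connected. Let $\boldsymbol{M}$ be the canonical transition matrix associated with $\mathrm{Samp}(\mathcal{Q};\mathcal{D})$ and let $\Gamma(\boldsymbol{M})$ be its absolute spectral gap. Then for any $\delta\in(0,1)$, the algorithm ExactSampler (described in the context) draws, with probability at least $1-\delta$, $$N=O\!\left(\frac{n\,\log(1/\mathcal{D}_{\min})}{\Gamma(\boldsymbol{M})}\,\log\frac1\delta\right)$$ samples from $\mathrm{Samp}(\mathcal{Q};\mathcal{D})$, runs in time polynomial in $N$, and outputs a sample distributed exactly according to $\mathcal{D}$.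
   Context: Pair distribution and its graph. A pair distribution $\mathcal{Q}$ on $[n]$ is a probability distribution on unordered pairs $\{x,y\}$ with $x\neq y$, $x,y\in[n]$; write $\mathcal{Q}(x,y)=\mathcal{Q}(y,x)$ for the probability of $\{x,y\}$. $G_{\mathcal{Q}}$ is the graph on vertex set $[n]$ with edge set $\mathcal{E}=\{\{x,y\}:\mathcal{Q}(x,y)>0\}$. Local Sampling Scheme. Each call to the oracle $\mathrm{Samp}(\mathcal{Q};\mathcal{D})$ independently returns $(i,j,w)$, where $\{i,j\}$ is drawn from $\mathcal{Q}$ and then the winner $w\in\{i,j\}$ is drawn from the conditional distribution $\mathcal{D}_{\{i,j\}}$, i.e. $\Pr[w=i]=\mathcal{D}(i)/(\mathcal{D}(i)+\mathcal{D}(j))$ and $\Pr[w=j]=\mathcal{D}(j)/(\mathcal{D}(i)+\mathcal{D}(j))$. Canonical transition matrix. $\boldsymbol{M}_{xy}=\mathcal{Q}(x,y)\,\frac{\mathcal{D}(y)}{\mathcal{D}(x)+\mathcal{D}(y)}$ for $x\neq y$, and $\boldsymbol{M}_{xx}=1-\sum_{y\neq x}\boldsymbol{M}_{xy}$. For a reversible transition matrix $\boldsymbol{P}$ with eigenvalues $1=\lambda_1\ge\lambda_2\ge\dots\ge\lambda_n\ge-1$, the absolute spectral gap is $\Gamma(\boldsymbol{P})=1-\max\{\lambda_2,|\lambda_n|\}$. Algorithm ExactSampler. Set $t\leftarrow 0$ and $F_0(x)\leftarrow x$ for all $x\in[n]$. While the map $F_t:[n]\to[n]$ is not constant ("has not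 coalesced"): set $t\leftarrow t-1$; draw one fresh sample $(i,j,w)$ from $\mathrm{Samp}(\mathcal{Q};\mathcal{D})$; for every $x\in[n]$, if $x\notin\{i,j\}$ or $x=w$ set $F_t(x)\leftarrow F_{t+1}(x)$, otherwise set $F_t(x)\leftarrow F_{t+1}(w)$. When the loop ends output $F_t(1)$. The parameter $\delta$ concerns only the number of samples drawn; the output is distributed exactly as $\mathcal{D}$. The $O(\cdot)$ hides an absolute constant, in the usual regime where $\delta$ is bounded away from $1$ (e.g. $\delta\le 1/2$). *)

theory Defs
  imports
    "HOL-Probability.Probability"
    "Jordan_Normal_Form.Char_Poly"
    "Graph_Theory.Digraph_Component"
begin

(* The ground set [n] is {1..n}; an unordered pair {x, y} is a two-element set,
   so the probability Q(x, y) is pmf Q {x, y}. *)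

definition pair_distribution :: "nat \<Rightarrow> nat set pmf \<Rightarrow> bool" where
  "pair_distribution n Q \<longleftrightarrow> set_pmf Q \<subseteq> {{x, y} | x y. x \<in> {1..n} \<and> y \<in> {1..n} \<and> x \<noteq> y}"

(* Every edge {x, y} is represented by the two arcs (x, y) and (y, x). *)
definition induced_graph :: "nat \<Rightarrow> nat set pmf \<Rightarrow> nat pair_pre_digraph" where
  "induced_graph n Q =
     \<lparr> pverts = {1..n},
       parcs = {(x, y). x \<in> {1..n} \<and> y \<in> {1..n} \<and> x \<noteq> y \<and> pmf Q {x, y} > 0} \<rparr>"

(* One oracle answer (i, j, w); the unordered pair {i, j} is listed with i < j. *)
definition samp :: "nat set pmf \<Rightarrow> nat pmf \<Rightarrow> (nat \<times> nat \<times> nat) pmf" where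
  "samp Q D = bind_pmf Q (\<lambda>e. map_pmf (\<lambda>w. (Min e, Max e, w)) (cond_pmf D e))"

(* Library row and column indices start at 0: index i stands for the element i + 1 of [n]. *)
definition canonical_matrix :: "nat \<Rightarrow> nat set pmf \<Rightarrow> nat pmf \<Rightarrow> real mat" where
  "canonical_matrix n Q D =
     (let M = (\<lambda>x y. pmf Q {x, y} * (pmf D y / (pmf D x + pmf D y)))
      in Matrix.mat n n (\<lambda>(i, j).
           if i \<noteq> j then M (Suc i) (Suc j)
           else 1 - (\<Sum>y \<in> {1..n} - {Suc i}. M (Suc i) y)))"

(* The real eigenvalues in decreasing order, repeated according to algebraic multiplicity.
   For a reversible transition matrix these are all the eigenvalues. *)
definition eigenvalues_desc :: "real mat \<Rightarrow> real list" where
  "eigenvalues_desc P = rev (sorted_list_of_multiset (proots (char_poly P)))"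

(* List positions start at 0, so lambda_k is found at position k - 1. *)
definition absolute_spectral_gap :: "real mat \<Rightarrow> real" where
  "absolute_spectral_gap P =
     (let ev = eigenvalues_desc P in 1 - max (ev ! 1) \<bar>ev ! (dim_row P - 1)\<bar>)"

(* The running time is the number of elementary operations on a unit-cost random access
   machine: comparisons, array reads and writes, counter updates and oracle calls.  The two
   inner loops over [n] return their result together with the time they take. *)

primrec coalescence_test :: "(nat \<Rightarrow> nat) \<Rightarrow> nat list \<Rightarrow> bool \<times> nat" where
  "coalescence_test F [] = (True, 1)"
| "coalescence_test F (x # xs) =
     (if F x = F 1
      then (let (b, c) = coalescence_test F xs in (b, c + 3))
      else (False, 3))"

(* F is the old map and G the new one under construction; the cost per element is at most
   three comparisons, one read and one write. *)
primrec update_map ::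
  "nat \<times> nat \<times> nat \<Rightarrow> (nat \<Rightarrow> nat) \<Rightarrow> (nat \<Rightarrow> nat) \<Rightarrow> nat list \<Rightarrow> (nat \<Rightarrow> nat) \<times> nat"
where
  "update_map s F G [] = (G, 1)"
| "update_map s F G (x # xs) =
     (let (i, j, w) = s;
          v = (if x \<notin> {i, j} \<or> x = w then F x else F w);
          (H, c) = update_map s F (G(x := v)) xs
      in (H, c + 5))"

lemma fst_coalescence_test:
  assumes "n \<ge> 1"
  shows "fst (coalescence_test F [1..<Suc n]) \<longleftrightarrow> (\<exists>c. \<forall>x \<in> {1..n}. F x = c)"
proof -
  have "fst (coalescence_test F xs) \<longleftrightarrow> (\<forall>x \<in> set xs. F x = F 1)" for xs
    by (induction xs) (auto split: prod.splits)
  moreover have "set [1..<Suc n] = {1..n}"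
    by auto
  ultimately have "fst (coalescence_test F [1..<Suc n]) \<longleftrightarrow> (\<forall>x \<in> {1..n}. F x = F 1)"
    by presburger
  also have "\<dots> \<longleftrightarrow> (\<exists>c. \<forall>x \<in> {1..n}. F x = c)"
    using assms by (metis atLeastAtMost_iff order_refl)
  finally show ?thesis .
qed

lemma fst_update_map:
  "fst (update_map (i, j, w) F F [1..<Suc n]) =
     (\<lambda>x. if x \<in> {1..n} \<and> \<not> (x \<notin> {i, j} \<or> x = w) then F w else F x)"
proof -
  have "fst (update_map (i, j, w) F G xs) =
      (\<lambda>x. if x \<in> set xs then (if x \<notin> {i, j} \<or> x = w then F x else F w) else G x)" for G xs
    by (induction xs arbitrary: G) (auto simp: fun_eq_iff Let_def case_prod_beta)
  moreover have "set [1..<Suc n] = {1..n}"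
    by auto
  ultimately show ?thesis
    by (auto simp: fun_eq_iff)
qed

(* The loop state is the current map F = F_t, the number N = -t of samples drawn so far and
   the time T spent so far.  A terminating run returns (output, samples drawn, time);
   nontermination is the missing mass of the subprobability distribution. *)
partial_function (spmf) sampler_loop ::
  "nat \<Rightarrow> nat set pmf \<Rightarrow> nat pmf \<Rightarrow> (nat \<Rightarrow> nat) \<Rightarrow> nat \<Rightarrow> nat \<Rightarrow> (nat \<times> nat \<times> nat) spmf"
where
  "sampler_loop n Q D F N T =
     (let (b, c) = coalescence_test F [1..<Suc n]
      in if b then return_spmf (F 1, N, T + c + 1)
         else bind_spmf (spmf_of_pmf (samp Q D)) (\<lambda>s.
                let (F', c') = update_map s F F [1..<Suc n]
                in sampler_loop n Q D F' (N + 1) (T + c + c' + 2)))"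

(* The initialisation of t and F_0 costs n + 1 writes. *)
definition exact_sampler ::
  "nat \<Rightarrow> nat set pmf \<Rightarrow> nat pmf \<Rightarrow> (nat \<times> nat \<times> nat) spmf"
where
  "exact_sampler n Q D = sampler_loop n Q D (\<lambda>x. x) 0 (n + 1)"

end

theory Submission
  imports Defs "Jordan_Normal_Form.Schur_Decomposition"
begin

text \<open>
  Write \<open>\<pi>\<close> for the target distribution. An oracle call on the pair \<open>e\<close> moves both points of \<open>e\<close> to the
  winner, so averaging a function over the winner is the orthogonal projection of
  \<open>L\<^sup>2(\<pi>)\<close> onto the functions that are constant on \<open>e\<close>; the canonical chain is the \<open>Q\<close>-mixture of these projections.

  The maps \<open>F\<^sub>t\<close> compose independent random maps, and a composition has the same law in either
  order. Hence the probability \<open>u\<^sub>k(x, y)\<close> that \<open>x\<close> and \<open>y\<close> are still separated after \<open>k\<close>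
  samples can be computed by moving two walkers until they meet. On functions of two variables
  that vanish on the diagonal, an oracle call on \<open>e\<close> acts as a projection whose
  loss of squared \<open>L\<^sup>2(\<pi> \<otimes> \<pi>)\<close> norm is exactly the Dirichlet energy of \<open>e\<close> in the two coordinates.
  The Poincare inequality in each coordinate, Efron--Stein, and
  the mass \<open>\<Sum>\<pi>(x)\<^sup>2 \<ge> 1/n\<close> of the diagonal make the squared norm of \<open>u\<^sub>k\<close> shrink by the factor \<open>1 - \<Gamma>/n\<close> in each step.
  Since \<open>\<pi>(x) \<pi>(y) u\<^sub>k(x, y)\<^sup>2\<close> is at most this norm, a union bound over \<open>x\<close> (against the point 1)
  gives the sample bound, and in particular almost sure termination.

  The output is exact because \<open>\<pi>\<close> is stationary for the random maps: the law of \<open>F(X)\<close> with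
  \<open>X \<sim> \<pi>\<close> is preserved on average by each iteration, and it is the point mass at the output once \<open>F\<close> is constant.
\<close>

section \<open>Spectrum of a reversible matrix\<close>

text \<open>Induction on the degree: the fundamental theorem of algebra supplies a complex root, the
  hypothesis makes it real, and dividing it off removes exactly one copy from
  \<open>proots\<close>.\<close>

lemma monic_real_rooted_splits:
  fixes p :: "real poly"
  assumes "lead_coeff p = 1" and "\<And>z. poly (map_poly complex_of_real p) z = 0 \<Longrightarrow> z \<in> \<real>"
  shows "p = (\<Prod>e\<in>#proots p. [:- e, 1:])"
  using assms
proof (induction "degree p" arbitrary: p rule: less_induct)
  case less
  interpret hom: map_poly_comm_ring_hom complex_of_real ..
  show ?case
  proof (cases "degree p = 0")
    case True
    then have "p = 1"
      using less.prems(1) by (metis degree_eq_zeroE lead_coeff_pCons(2) one_pCons)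
    then show ?thesis by simp
  next
    case False
    have "degree (map_poly complex_of_real p) = degree p"
      by (rule degree_map_poly) auto
    with False have "\<not> constant (poly (map_poly complex_of_real p))"
      by (simp add: constant_degree)
    then obtain z where z: "poly (map_poly complex_of_real p) z = 0"
      using fundamental_theorem_of_algebra by blast
    with less.prems(2) obtain r where r: "z = complex_of_real r"
      by (metis Reals_cases)
    have "complex_of_real (poly p r) = 0"
      using z unfolding r by (simp add: of_real_hom.poly_map_poly)
    then have "poly p r = 0" by simp
    then obtain q where q: "p = [:- r, 1:] * q"
      by (metis dvdE poly_eq_0_iff_dvd)
    have q0: "q \<noteq> 0" using q less.prems(1) by auto
    have deg: "degree p = Suc (degree q)"
      unfolding q using q0 by (subst degree_mult_eq) auto
    have lq: "lead_coeff q = 1"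
      using less.prems(1) unfolding q lead_coeff_mult by simp
    have "z' \<in> \<real>" if "poly (map_poly complex_of_real q) z' = 0" for z'
    proof (rule less.prems(2))
      show "poly (map_poly complex_of_real p) z' = 0"
        unfolding q by (simp only: hom.hom_mult poly_mult that) simp
    qed
    then have IH: "q = (\<Prod>e\<in>#proots q. [:- e, 1:])"
      using deg lq by (intro less.hyps) auto
    have "proots p = {#r#} + proots q"
      unfolding q using q0 by (subst proots_mult) auto
    then have "(\<Prod>e\<in>#proots p. [:- e, 1:]) = [:- r, 1:] * (\<Prod>e\<in>#proots q. [:- e, 1:])"
      by simp
    also have "\<dots> = p" using IH q by simp
    finally show ?thesis by simp
  qed
qed

text \<open>Detailed balance makes \<open>A\<close> self-adjoint for the Hermitian form with weights
  \<open>w\<close>. Hence \<open>S\<close>, the form at \<open>A v\<close> and \<open>v\<close>, is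
  its own conjugate, and it equals \<open>z\<close> times the positive number
  \<open>R\<close>.\<close>

lemma reversible_eigenvalue_real:
  fixes A :: "real mat"
  assumes A: "A \<in> carrier_mat n n"
    and w: "\<And>i. i < n \<Longrightarrow> w i > 0"
    and sym: "\<And>i j. i < n \<Longrightarrow> j < n \<Longrightarrow> w i * A $$ (i, j) = w j * A $$ (j, i)"
    and ev: "eigenvalue (map_mat complex_of_real A) z"
  shows "z \<in> \<real>"
proof -
  obtain v where v: "v \<in> carrier_vec n" "v \<noteq> 0\<^sub>v n"
      "map_mat complex_of_real A *\<^sub>v v = z \<cdot>\<^sub>v v"
    using ev A unfolding eigenvalue_def eigenvector_def by auto
  define f where "f i = vec_index v i" for i
  have Av: "(\<Sum>j<n. complex_of_real (A $$ (i, j)) * f j) = z * f i" if "i < n" for i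
  proof -
    have "vec_index (map_mat complex_of_real A *\<^sub>v v) i = z * f i"
      using v that by (simp add: f_def)
    moreover have "vec_index (map_mat complex_of_real A *\<^sub>v v) i = (\<Sum>j<n. complex_of_real (A $$ (i, j)) * f j)"
      using A v(1) that by (simp add: scalar_prod_def f_def atLeast0LessThan)
    ultimately show ?thesis by simp
  qed
  define S where "S = (\<Sum>i<n. complex_of_real (w i) * cnj (f i) * (\<Sum>j<n. complex_of_real (A $$ (i, j)) * f j))"
  define R where "R = (\<Sum>i<n. w i * (cmod (f i))\<^sup>2)"
  have S1: "S = z * complex_of_real R"
  proof -
    have "S = (\<Sum>i<n. complex_of_real (w i) * cnj (f i) * (z * f i))"
      unfolding S_def by (rule sum.cong) (simp_all add: Av)
    also have "\<dots> = z * complex_of_real R"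
      unfolding R_def of_real_sum sum_distrib_left
      by (rule sum.cong) (simp_all add: complex_norm_square mult_ac del: of_real_power)
    finally show ?thesis .
  qed
  have "cnj S = (\<Sum>i<n. \<Sum>j<n. complex_of_real (w i * A $$ (i, j)) * f i * cnj (f j))"
    unfolding S_def cnj_sum complex_cnj_mult sum_distrib_left
    by (intro sum.cong refl) (simp add: mult_ac)
  also have "\<dots> = (\<Sum>i<n. \<Sum>j<n. complex_of_real (w j * A $$ (j, i)) * f i * cnj (f j))"
    by (intro sum.cong refl) (simp only: sym lessThan_iff)
  also have "\<dots> = (\<Sum>j<n. \<Sum>i<n. complex_of_real (w j * A $$ (j, i)) * f i * cnj (f j))"
    by (rule sum.swap)
  also have "\<dots> = S"
    unfolding S_def sum_distrib_left by (intro sum.cong refl) (simp add: mult_ac)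
  finally have "cnj S = S" .
  obtain i where i: "i < n" "f i \<noteq> 0"
    using v(1,2) unfolding f_def by (metis carrier_vecD eq_vecI index_zero_vec)
  have "w i * (cmod (f i))\<^sup>2 \<le> R"
    unfolding R_def by (rule member_le_sum) (use i less_imp_le[OF w] in auto)
  moreover have "0 < w i * (cmod (f i))\<^sup>2" using i w by simp
  ultimately have "R \<noteq> 0" by linarith
  have "z * complex_of_real R = cnj z * complex_of_real R"
    using \<open>cnj S = S\<close> unfolding S1 by (metis complex_cnj_complex_of_real complex_cnj_mult)
  with \<open>R \<noteq> 0\<close> have "cnj z = z" by (metis mult_right_cancel of_real_eq_0_iff)
  then show ?thesis by (simp add: Reals_cnj_iff)
qed

text \<open>\<open>eigenvalues_desc\<close> lists real roots only. All complex eigenvalues are real,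
  so none is missing and the list factors the characteristic polynomial, as the Schur decomposition
  requires.\<close>

lemma reversible_eigenvalues_desc:
  assumes A: "A \<in> carrier_mat n n"
    and w: "\<And>i. i < n \<Longrightarrow> w i > 0"
    and sym: "\<And>i j. i < n \<Longrightarrow> j < n \<Longrightarrow> w i * A $$ (i, j) = w j * A $$ (j, i)"
  shows "char_poly A = (\<Prod>e\<leftarrow>eigenvalues_desc A. [:- e, 1:])"
    and "length (eigenvalues_desc A) = n"
    and "sorted_wrt (\<ge>) (eigenvalues_desc A)"
proof -
  let ?p = "char_poly A"
  have deg: "degree ?p = n" "lead_coeff ?p = 1"
    using degree_monic_char_poly[OF A] by auto
  have "z \<in> \<real>" if "poly (map_poly complex_of_real ?p) z = 0" for z
  proof (rule reversible_eigenvalue_real[OF A w sym])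
    have "map_mat complex_of_real A \<in> carrier_mat n n" using A by simp
    then show "eigenvalue (map_mat complex_of_real A) z"
      using that eigenvalue_root_char_poly of_real_hom.char_poly_hom[OF A] by metis
  qed
  then have split: "?p = (\<Prod>e\<in>#proots ?p. [:- e, 1:])"
    by (intro monic_real_rooted_splits deg)
  have mset: "mset (eigenvalues_desc A) = proots ?p"
    unfolding eigenvalues_desc_def by simp
  have "(\<Prod>e\<in>#proots ?p. [:- e, 1:]) = prod_list (map (\<lambda>e. [:- e, 1:]) (eigenvalues_desc A))"
    unfolding mset[symmetric] by (metis mset_map prod_mset_prod_list)
  with split show prod: "?p = (\<Prod>e\<leftarrow>eigenvalues_desc A. [:- e, 1:])" by simp
  show "length (eigenvalues_desc A) = n"
    using degree_linear_factors[of uminus "eigenvalues_desc A"] prod deg(1) by simp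
  show "sorted_wrt (\<ge>) (eigenvalues_desc A)"
    unfolding eigenvalues_desc_def sorted_wrt_rev by simp
qed

section \<open>Weighted inner products and Gram--Schmidt\<close>

locale weighted_space =
  fixes I :: "'a set" and w :: "'a \<Rightarrow> real"
  assumes finite_I: "finite I" and w_pos: "x \<in> I \<Longrightarrow> w x > 0"
begin

definition ip :: "('a \<Rightarrow> real) \<Rightarrow> ('a \<Rightarrow> real) \<Rightarrow> real" where
  "ip f g = (\<Sum>x\<in>I. w x * f x * g x)"

definition in_span :: "(nat \<Rightarrow> 'a \<Rightarrow> real) \<Rightarrow> nat \<Rightarrow> ('a \<Rightarrow> real) \<Rightarrow> bool" where
  "in_span p k f \<longleftrightarrow> (\<exists>c. \<forall>x\<in>I. f x = (\<Sum>l<k. c l * p l x))"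

lemma ip_commute: "ip f g = ip g f"
  unfolding ip_def by (simp add: mult_ac)

lemma ip_cong: "(\<And>x. x \<in> I \<Longrightarrow> f x = f' x) \<Longrightarrow> (\<And>x. x \<in> I \<Longrightarrow> g x = g' x) \<Longrightarrow> ip f g = ip f' g'"
  unfolding ip_def by (intro sum.cong) auto

lemma ip_add_left: "ip (\<lambda>x. f x + g x) h = ip f h + ip g h"
  unfolding ip_def by (simp add: algebra_simps sum.distrib)

lemma ip_diff_left: "ip (\<lambda>x. f x - g x) h = ip f h - ip g h"
  unfolding ip_def by (simp add: algebra_simps sum_subtractf)

lemma ip_scale_left: "ip (\<lambda>x. c * f x) h = c * ip f h"
  unfolding ip_def by (simp add: sum_distrib_left mult_ac)

lemma ip_sum_left: "ip (\<lambda>x. \<Sum>l\<in>L. c l * p l x) h = (\<Sum>l\<in>L. c l * ip (p l) h)"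
  unfolding ip_def by (simp add: sum_distrib_left sum_distrib_right mult_ac sum.swap[of _ I])

lemma ip_sum_right: "ip h (\<lambda>x. \<Sum>l\<in>L. c l * p l x) = (\<Sum>l\<in>L. c l * ip h (p l))"
  using ip_sum_left[of c p L h] by (simp add: ip_commute)

lemma ip_self_nonneg: "ip f f \<ge> 0"
  unfolding ip_def by (intro sum_nonneg) (simp add: mult.assoc w_pos less_imp_le)

lemma ip_self_eq_0: "ip f f = 0 \<longleftrightarrow> (\<forall>x\<in>I. f x = 0)"
proof -
  have "ip f f = 0 \<longleftrightarrow> (\<forall>x\<in>I. w x * f x * f x = 0)"
    unfolding ip_def using finite_I
    by (intro sum_nonneg_eq_0_iff) (auto simp: mult.assoc less_imp_le w_pos)
  then show ?thesis using w_pos by (metis less_irrefl mult_eq_0_iff)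
qed

lemma in_span_base: "l < k \<Longrightarrow> in_span p k (p l)"
  unfolding in_span_def by (rule exI[of _ "\<lambda>m. if m = l then 1 else 0"]) (simp add: if_distrib if_distribR cong: if_cong)

lemma in_span_mono:
  assumes "in_span p k f" "k \<le> k'"
  shows "in_span p k' f"
proof -
  obtain c where c: "\<forall>x\<in>I. f x = (\<Sum>l<k. c l * p l x)"
    using assms(1) unfolding in_span_def by blast
  have "(\<Sum>l<k'. (if l < k then c l else 0) * p l x) = (\<Sum>l<k. c l * p l x)" for x
    by (rule sum.mono_neutral_cong_right) (use assms(2) in auto)
  with c show ?thesis
    unfolding in_span_def by (intro exI[of _ "\<lambda>l. if l < k then c l else 0"]) simp
qed

lemma in_span_comb:
  assumes "in_span p k f" "in_span p k g"
  shows "in_span p k (\<lambda>x. a * f x + b * g x)"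
proof -
  obtain c d where c: "\<forall>x\<in>I. f x = (\<Sum>l<k. c l * p l x)" "\<forall>x\<in>I. g x = (\<Sum>l<k. d l * p l x)"
    using assms unfolding in_span_def by blast
  show ?thesis
    unfolding in_span_def using c
    by (intro exI[of _ "\<lambda>l. a * c l + b * d l"])
      (simp add: sum_distrib_left sum.distrib algebra_simps)
qed

lemma in_span_eqI: "in_span p k f \<Longrightarrow> (\<And>x. x \<in> I \<Longrightarrow> g x = f x) \<Longrightarrow> in_span p k g"
  unfolding in_span_def by simp

lemma in_span_ip_0:
  assumes "in_span p k f" "\<And>l. l < k \<Longrightarrow> ip g (p l) = 0"
  shows "ip g f = 0"
proof -
  obtain c where c: "\<forall>x\<in>I. f x = (\<Sum>l<k. c l * p l x)"
    using assms(1) unfolding in_span_def by blast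
  have "ip g f = ip g (\<lambda>x. \<Sum>l<k. c l * p l x)"
    by (rule ip_cong) (simp_all add: c)
  also have "\<dots> = 0" using assms(2) by (simp add: ip_sum_right)
  finally show ?thesis .
qed

text \<open>Gram--Schmidt: \<open>q\<close> is the part of \<open>p k\<close> orthogonal to the
  earlier functions, and the projection of \<open>f\<close> gains its component along
  \<open>q\<close>. The family \<open>p\<close> may be dependent, so \<open>q\<close> may vanish on
  \<open>I\<close>.\<close>

lemma projection_exists: "\<exists>u. in_span p k u \<and> (\<forall>l<k. ip (\<lambda>x. f x - u x) (p l) = 0)"
proof (induction k arbitrary: f)
  case 0
  show ?case by (intro exI[of _ "\<lambda>_. 0"]) (simp add: in_span_def)
next
  case (Suc k)
  obtain u where u: "in_span p k u" "\<And>l. l < k \<Longrightarrow> ip (\<lambda>x. f x - u x) (p l) = 0"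
    using Suc.IH by blast
  obtain v where v: "in_span p k v" "\<And>l. l < k \<Longrightarrow> ip (\<lambda>x. p k x - v x) (p l) = 0"
    using Suc.IH by blast
  define q where "q x = p k x - v x" for x
  have pk: "p k x = q x + v x" for x by (simp add: q_def)
  have q: "in_span p (Suc k) q"
    using in_span_comb[OF in_span_base[of k "Suc k" p] in_span_mono[OF v(1)], of 1 "-1"]
    by (simp add: q_def[abs_def])
  \<comment> \<open>If \<open>ip q q = 0\<close>, division by zero makes \<open>r\<close> zero;
    \<open>q\<close> then vanishes on \<open>I\<close>, so orthogonality to it is automatic.\<close>
  define r where "r = ip (\<lambda>x. f x - u x) q / ip q q"
  define u' where "u' x = 1 * u x + r * q x" for x
  have span: "in_span p (Suc k) u'"
    unfolding u'_def by (intro in_span_comb in_span_mono[OF u(1)] q) simp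
  have fu': "(\<lambda>x. f x - u' x) = (\<lambda>x. (f x - u x) - r * q x)"
    by (auto simp: u'_def)
  have orth: "ip (\<lambda>x. f x - u' x) (p l) = 0" if "l < k" for l
    unfolding fu' using u(2)[OF that] v(2)[OF that, folded q_def]
    by (simp add: ip_diff_left[of "\<lambda>x. f x - u x"] ip_scale_left)
  have q0: "ip (\<lambda>x. f x - u' x) q = 0"
  proof (cases "ip q q = 0")
    case True
    then have "\<forall>x\<in>I. q x = 0" by (simp add: ip_self_eq_0)
    then show ?thesis by (simp add: ip_def)
  next
    case False
    moreover have "ip (\<lambda>x. f x - u' x) q = ip (\<lambda>x. f x - u x) q - r * ip q q"
      unfolding fu' by (simp add: ip_diff_left[of "\<lambda>x. f x - u x"] ip_scale_left)
    ultimately show ?thesis by (simp add: r_def)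
  qed
  have "ip (\<lambda>x. f x - u' x) (p k) = ip (\<lambda>x. f x - u' x) q + ip (\<lambda>x. f x - u' x) v"
    unfolding ip_commute[of "\<lambda>x. f x - u' x"] ip_add_left[symmetric] by (simp add: q_def)
  also have "\<dots> = 0"
    using q0 in_span_ip_0[OF v(1) orth] by simp
  finally show ?case
    using span orth by (intro exI[of _ u']) (auto simp: less_Suc_eq)
qed

text \<open>
  In the Gram--Schmidt basis of a triangular family, \<open>T q\<^sub>k - e\<^sub>k q\<^sub>k\<close> lies in the span of the
  earlier vectors, and self-adjointness makes it orthogonal to that span.
\<close>
lemma orthogonal_eigenbasis:
  fixes T :: "('a \<Rightarrow> real) \<Rightarrow> 'a \<Rightarrow> real"
  assumes T: "\<And>f x. x \<in> I \<Longrightarrow> T f x = (\<Sum>y\<in>I. a x y * f y)"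
    and sym: "\<And>x y. x \<in> I \<Longrightarrow> y \<in> I \<Longrightarrow> w x * a x y = w y * a y x"
    and tri: "\<And>k. k < m \<Longrightarrow> in_span p k (\<lambda>x. T (p k) x - e k * p k x)"
    and indep: "\<And>k. k < m \<Longrightarrow> \<not> in_span p k (p k)"
  obtains q where "\<And>k. k < m \<Longrightarrow> ip (q k) (q k) > 0"
    and "\<And>k x. k < m \<Longrightarrow> x \<in> I \<Longrightarrow> T (q k) x = e k * q k x"
    and "\<And>k l. k < m \<Longrightarrow> l < m \<Longrightarrow> k \<noteq> l \<Longrightarrow> ip (q k) (q l) = 0"
    and "\<And>f. in_span p m f \<Longrightarrow> in_span q m f"
proof -
  have T_cong: "T f x = T g x" if "x \<in> I" "\<And>y. y \<in> I \<Longrightarrow> f y = g y" for f g x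
    using that by (simp add: T)
  have T_diff: "T (\<lambda>y. f y - g y) x = T f x - T g x" if "x \<in> I" for f g x
    using that by (simp add: T algebra_simps sum_subtractf)
  have T_sum: "T (\<lambda>y. \<Sum>l<k. c l * p l y) x = (\<Sum>l<k. c l * T (p l) x)" if "x \<in> I" for c k x
    using that by (simp add: T sum_distrib_left mult_ac sum.swap[of _ I])
  have selfadj: "ip (T f) g = ip f (T g)" for f g
  proof -
    have "ip (T f) g = (\<Sum>x\<in>I. \<Sum>y\<in>I. (w x * a x y) * f y * g x)"
      unfolding ip_def by (intro sum.cong refl) (simp add: T sum_distrib_left sum_distrib_right mult_ac)
    also have "\<dots> = (\<Sum>x\<in>I. \<Sum>y\<in>I. (w y * a y x) * f y * g x)"
      by (intro sum.cong refl) (simp only: sym)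
    also have "\<dots> = (\<Sum>y\<in>I. \<Sum>x\<in>I. (w y * a y x) * f y * g x)"
      by (rule sum.swap)
    also have "\<dots> = ip f (T g)"
      unfolding ip_def by (intro sum.cong refl) (simp add: T sum_distrib_left sum_distrib_right mult_ac)
    finally show ?thesis .
  qed
  \<comment> \<open>Triangularity makes each initial span invariant under \<open>T\<close>. Below,
    this keeps both the residual \<open>r\<close> and \<open>T r\<close> in the span of the
    functions before \<open>p k\<close>.\<close>
  have T_span: "in_span p k (T f)" if f: "in_span p k f" and k: "k \<le> m" for k f
    using f k
  proof (induction k arbitrary: f)
    case 0
    then have "\<forall>x\<in>I. f x = 0" by (simp add: in_span_def)
    then have "\<forall>x\<in>I. T f x = 0" by (simp add: T)
    then show ?case by (simp add: in_span_def)
  next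
    case (Suc k)
    obtain c where c: "\<forall>x\<in>I. f x = (\<Sum>l<Suc k. c l * p l x)"
      using Suc.prems unfolding in_span_def by blast
    define g where "g x = (\<Sum>l<k. c l * p l x)" for x
    have g: "in_span p k g" by (auto simp: in_span_def g_def)
    let ?h = "\<lambda>x. 1 * T g x + c k * (1 * (T (p k) x - e k * p k x) + e k * p k x)"
    have "in_span p (Suc k) ?h"
      by (intro in_span_comb in_span_mono[OF Suc.IH[OF g]] in_span_mono[OF tri] in_span_base)
        (use Suc.prems in auto)
    moreover have "T f x = ?h x" if x: "x \<in> I" for x
    proof -
      have "T f x = T (\<lambda>y. \<Sum>l<Suc k. c l * p l y) x"
        by (rule T_cong[OF x]) (simp add: c del: sum.lessThan_Suc)
      also have "\<dots> = (\<Sum>l<Suc k. c l * T (p l) x)" by (rule T_sum[OF x])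
      also have "\<dots> = T g x + c k * T (p k) x"
        using T_sum[OF x, of c k] by (simp add: g_def[abs_def])
      finally show ?thesis by simp
    qed
    ultimately show ?case by (rule in_span_eqI)
  qed
  have "\<forall>k. \<exists>v. in_span p k v \<and> (\<forall>l<k. ip (\<lambda>x. p k x - v x) (p l) = 0)"
    by (intro allI projection_exists)
  from choice[OF this] obtain u where u: "\<And>k. in_span p k (u k)"
    and orth: "\<And>k l. l < k \<Longrightarrow> ip (\<lambda>x. p k x - u k x) (p l) = 0"
    by blast
  define q where "q k x = p k x - u k x" for k x
  have orth: "ip (q k) (p l) = 0" if "l < k" for k l
    using orth[OF that] by (simp add: q_def[abs_def])
  have q_span: "in_span p (Suc k) (q k)" for k
    using in_span_comb[OF in_span_base[of k "Suc k" p] in_span_mono[OF u[of k]], of 1 "-1"]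
    by (simp add: q_def[abs_def])
  have q_orth: "ip (q k) f = 0" if "in_span p k f" for k f
    using in_span_ip_0[OF that orth] .
  show thesis
  proof
    show "ip (q k) (q k) > 0" if k: "k < m" for k
    proof (rule ccontr)
      assume "\<not> ip (q k) (q k) > 0"
      then have "ip (q k) (q k) = 0" using ip_self_nonneg[of "q k"] by linarith
      then have "\<And>x. x \<in> I \<Longrightarrow> p k x = u k x" by (simp add: ip_self_eq_0 q_def)
      then show False using in_span_eqI[OF u[of k]] indep[OF k] by blast
    qed
    show "T (q k) x = e k * q k x" if k: "k < m" and x: "x \<in> I" for k x
    proof -
      define r where "r y = T (q k) y - e k * q k y" for y
      have "in_span p k r"
      proof -
        let ?h = "\<lambda>y. 1 * (T (p k) y - e k * p k y) + (-1) * (1 * T (u k) y + (- e k) * u k y)"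
        have "in_span p k ?h"
          by (intro in_span_comb tri[OF k] T_span[OF u] u) (use k in auto)
        moreover have "r y = ?h y" if "y \<in> I" for y
          using T_diff[OF that, of "p k" "u k"] by (simp add: r_def q_def[abs_def] algebra_simps)
        ultimately show ?thesis by (rule in_span_eqI)
      qed
      then have "ip (T (q k)) r = 0" "ip (q k) r = 0"
        using q_orth[of k "T r"] q_orth[of k r] T_span[of k r] k by (auto simp: selfadj)
      then have "ip r r = 0"
        unfolding r_def[abs_def] by (simp add: ip_diff_left ip_scale_left)
      then show ?thesis using x by (simp add: ip_self_eq_0 r_def)
    qed
    have "ip (q k) (q l) = 0" if "l < k" for k l
      using q_orth[OF in_span_mono[OF q_span]] that by simp
    then show "ip (q k) (q l) = 0" if "k < m" "l < m" "k \<noteq> l" for k l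
      using that by (metis ip_commute linorder_neqE_nat)
    have "in_span q k f" if "in_span p k f" for k f
      using that
    proof (induction k arbitrary: f)
      case 0
      then show ?case by (simp add: in_span_def)
    next
      case (Suc k)
      obtain c where c: "\<forall>x\<in>I. f x = (\<Sum>l<Suc k. c l * p l x)"
        using Suc.prems unfolding in_span_def by blast
      have g: "in_span p k (\<lambda>x. \<Sum>l<k. c l * p l x)" by (auto simp: in_span_def)
      have "in_span q (Suc k) (\<lambda>x. 1 * (\<Sum>l<k. c l * p l x) + c k * (1 * q k x + 1 * u k x))"
        by (intro in_span_comb in_span_mono[OF Suc.IH[OF g]] in_span_mono[OF Suc.IH[OF u]] in_span_base) auto
      then show ?case
        by (rule in_span_eqI) (simp add: c q_def)
    qed
    then show "in_span q m f" if "in_span p m f" for f using that .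
  qed
qed

end

text \<open>The family \<open>p\<close> consists of the columns of \<open>P\<close> in the Schur
  decomposition \<open>A = P * B * Q\<close>: upper triangularity of \<open>B\<close> gives the
  triangular action with the eigenvalues in order, \<open>Q * P = 1\<close> gives independence, and
  \<open>P * Q = 1\<close> gives spanning.\<close>

lemma reversible_schur_columns:
  fixes A :: "real mat"
  assumes A: "A \<in> carrier_mat n n"
    and w: "\<And>i. i < n \<Longrightarrow> w i > 0"
    and sym: "\<And>i j. i < n \<Longrightarrow> j < n \<Longrightarrow> w i * A $$ (i, j) = w j * A $$ (j, i)"
  obtains p :: "nat \<Rightarrow> nat \<Rightarrow> real" and b :: "nat \<Rightarrow> nat \<Rightarrow> real"
  where "\<And>i k. i < n \<Longrightarrow> k < n \<Longrightarrow>
      (\<Sum>j<n. A $$ (i, j) * p k j) - eigenvalues_desc A ! k * p k i = (\<Sum>l<k. b l k * p l i)"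
    and "\<And>k c. k < n \<Longrightarrow> \<exists>i<n. p k i \<noteq> (\<Sum>l<k. c l * p l i)"
    and "\<And>f. \<exists>c. \<forall>i<n. f i = (\<Sum>l<n. c l * p l i)"
proof -
  let ?es = "eigenvalues_desc A"
  note facts = reversible_eigenvalues_desc[OF A w sym]
  obtain B P Q where BPQ: "schur_decomposition A ?es = (B, P, Q)"
    by (metis prod_cases3)
  from schur_decomposition[OF A facts(1) BPQ]
  have sim: "similar_mat_wit A B P Q" and up: "upper_triangular B" and diag: "diag_mat B = ?es"
    by auto
  note D = similar_mat_witD2[OF A sim]
  have car: "B \<in> carrier_mat n n" "P \<in> carrier_mat n n" "Q \<in> carrier_mat n n"
    and PQ: "P * Q = 1\<^sub>m n" and QP: "Q * P = 1\<^sub>m n" and AP: "A = P * B * Q"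
    using D by auto
  define p where "p k i = P $$ (i, k)" for k i
  have AP': "A * P = P * B"
  proof -
    have "A * P = P * B * (Q * P)"
      unfolding AP using car by (simp add: assoc_mult_mat[of _ n n _ n _ n])
    then show ?thesis using QP car by simp
  qed
  have Bdiag: "B $$ (k, k) = ?es ! k" if "k < n" for k
    using arg_cong[OF diag, of "\<lambda>xs. xs ! k"] that car by (simp add: diag_mat_def)
  have QPij: "(\<Sum>i<n. Q $$ (l, i) * P $$ (i, k)) = (if l = k then 1 else 0)" if "l < n" "k < n" for l k
  proof -
    have "(Q * P) $$ (l, k) = (\<Sum>i<n. Q $$ (l, i) * P $$ (i, k))"
      using that car by (simp add: scalar_prod_def atLeast0LessThan)
    then show ?thesis using QP that by simp
  qed
  have PQij: "(\<Sum>l<n. P $$ (i, l) * Q $$ (l, j)) = (if i = j then 1 else 0)" if "i < n" "j < n" for i j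
  proof -
    have "(P * Q) $$ (i, j) = (\<Sum>l<n. P $$ (i, l) * Q $$ (l, j))"
      using that car by (simp add: scalar_prod_def atLeast0LessThan)
    then show ?thesis using PQ that by simp
  qed
  show thesis
  proof
    show "(\<Sum>j<n. A $$ (i, j) * p k j) - ?es ! k * p k i = (\<Sum>l<k. B $$ (l, k) * p l i)"
      if "i < n" "k < n" for i k
    proof -
      have "(\<Sum>j<n. A $$ (i, j) * p k j) = (A * P) $$ (i, k)"
        using that A car by (simp add: scalar_prod_def atLeast0LessThan p_def)
      also have "\<dots> = (\<Sum>l<n. P $$ (i, l) * B $$ (l, k))"
        unfolding AP' using that car by (simp add: scalar_prod_def atLeast0LessThan)
      also have "\<dots> = (\<Sum>l<Suc k. P $$ (i, l) * B $$ (l, k))"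
        by (rule sum.mono_neutral_right) (use that car upper_triangularD[OF up] in auto)
      also have "\<dots> = (\<Sum>l<k. B $$ (l, k) * p l i) + ?es ! k * p k i"
        using Bdiag that by (simp add: p_def mult.commute)
      finally show ?thesis by simp
    qed
    show "\<exists>i<n. p k i \<noteq> (\<Sum>l<k. c l * p l i)" if k: "k < n" for k c
    proof (rule ccontr)
      assume "\<not> ?thesis"
      then have eq: "P $$ (i, k) = (\<Sum>l<k. c l * P $$ (i, l))" if "i < n" for i
        using that by (auto simp: p_def)
      \<comment> \<open>Row \<open>k\<close> of \<open>Q\<close> pairs to 1 with column
        \<open>k\<close> of \<open>P\<close> and to 0 with every earlier column.\<close>
      have "1 = (\<Sum>i<n. Q $$ (k, i) * P $$ (i, k))" using QPij[OF k k] by simp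
      also have "\<dots> = (\<Sum>i<n. \<Sum>l<k. c l * (Q $$ (k, i) * P $$ (i, l)))"
        by (intro sum.cong refl) (simp add: eq sum_distrib_left mult_ac)
      also have "\<dots> = (\<Sum>l<k. c l * (\<Sum>i<n. Q $$ (k, i) * P $$ (i, l)))"
        by (subst sum.swap) (simp add: sum_distrib_left)
      also have "\<dots> = 0"
        by (intro sum.neutral ballI) (use QPij k in auto)
      finally show False by simp
    qed
    show "\<exists>c. \<forall>i<n. f i = (\<Sum>l<n. c l * p l i)" for f
    proof (intro exI allI impI)
      fix i assume i: "i < n"
      have "(\<Sum>l<n. (\<Sum>j<n. Q $$ (l, j) * f j) * p l i) = (\<Sum>l<n. \<Sum>j<n. f j * (P $$ (i, l) * Q $$ (l, j)))"
        unfolding p_def sum_distrib_right by (intro sum.cong refl) simp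
      also have "\<dots> = (\<Sum>j<n. f j * (\<Sum>l<n. P $$ (i, l) * Q $$ (l, j)))"
        by (subst sum.swap) (simp add: sum_distrib_left)
      also have "\<dots> = (\<Sum>j<n. if i = j then f j else 0)"
        by (intro sum.cong refl) (use PQij i in auto)
      also have "\<dots> = f i" using i by simp
      finally show "f i = (\<Sum>l<n. (\<Sum>j<n. Q $$ (l, j) * f j) * p l i)" ..
    qed
  qed
qed

text \<open>The functions live on the 1-based set [n], the matrix has 0-based indices.\<close>
lemma reversible_eigenbasis:
  fixes A :: "real mat" and w :: "nat \<Rightarrow> real"
  assumes A: "A \<in> carrier_mat n n"
    and w: "\<And>x. x \<in> {1..n} \<Longrightarrow> w x > 0"
    and sym: "\<And>x y. x \<in> {1..n} \<Longrightarrow> y \<in> {1..n} \<Longrightarrow>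
      w x * A $$ (x - 1, y - 1) = w y * A $$ (y - 1, x - 1)"
  defines ip_eq: "ip \<equiv> weighted_space.ip {1..n} w"
  obtains q where "\<And>k. k < n \<Longrightarrow> ip (q k) (q k) > 0"
    and "\<And>k x. k < n \<Longrightarrow> x \<in> {1..n} \<Longrightarrow>
      (\<Sum>y\<in>{1..n}. A $$ (x - 1, y - 1) * q k y) = eigenvalues_desc A ! k * q k x"
    and "\<And>k l. k < n \<Longrightarrow> l < n \<Longrightarrow> k \<noteq> l \<Longrightarrow> ip (q k) (q l) = 0"
    and "\<And>f. \<exists>c. \<forall>x\<in>{1..n}. f x = (\<Sum>l<n. c l * q l x)"
proof -
  interpret weighted_space "{1..n}" w
    by standard (auto simp: w)
  have sym': "w (Suc i) * A $$ (i, j) = w (Suc j) * A $$ (j, i)" if "i < n" "j < n" for i j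
    using sym[of "Suc i" "Suc j"] that by simp
  have w': "w (Suc i) > 0" if "i < n" for i using w that by simp
  have reindex: "(\<Sum>y\<in>{1..n}. h y) = (\<Sum>j<n. h (Suc j))" for h :: "nat \<Rightarrow> real"
    by (rule sum.reindex_bij_witness[of _ Suc "\<lambda>y. y - 1"]) auto
  obtain p b where p1: "\<And>i k. i < n \<Longrightarrow> k < n \<Longrightarrow>
      (\<Sum>j<n. A $$ (i, j) * p k j) - eigenvalues_desc A ! k * p k i = (\<Sum>l<k. b l k * p l i)"
    and p2: "\<And>k c. k < n \<Longrightarrow> \<exists>i<n. p k i \<noteq> (\<Sum>l<k. c l * p l i)"
    and p3: "\<And>f. \<exists>c. \<forall>i<n. f i = (\<Sum>l<n. c l * p l i)"
    by (rule reversible_schur_columns[of A n "\<lambda>i. w (Suc i)", OF A w' sym']) (assumption | rule that)+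
  define p' where "p' k x = p k (x - 1)" for k x
  define T where "T f x = (\<Sum>y\<in>{1..n}. A $$ (x - 1, y - 1) * f y)" for f x
  have tri: "in_span p' k (\<lambda>x. T (p' k) x - eigenvalues_desc A ! k * p' k x)" if "k < n" for k
    unfolding in_span_def T_def p'_def reindex
    by (rule exI[of _ "\<lambda>l. b l k"]) (use that p1 in auto)
  have indep: "\<not> in_span p' k (p' k)" if "k < n" for k
  proof
    assume "in_span p' k (p' k)"
    then obtain c where c: "\<And>x. x \<in> {1..n} \<Longrightarrow> p k (x - 1) = (\<Sum>l<k. c l * p l (x - 1))"
      unfolding in_span_def p'_def by blast
    have "p k i = (\<Sum>l<k. c l * p l i)" if "i < n" for i
      using c[of "Suc i"] that by simp
    then show False using p2[OF \<open>k < n\<close>, of c] by blast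
  qed
  have full: "in_span p' n f" for f
  proof -
    obtain c where "\<forall>i<n. f (Suc i) = (\<Sum>l<n. c l * p l i)"
      using p3[of "\<lambda>i. f (Suc i)"] by blast
    then have "f x = (\<Sum>l<n. c l * p' l x)" if "x \<in> {1..n}" for x
      using that unfolding p'_def by (cases x) auto
    then show ?thesis unfolding in_span_def by blast
  qed
  obtain q where q: "\<And>k. k < n \<Longrightarrow> local.ip (q k) (q k) > 0"
      "\<And>k x. k < n \<Longrightarrow> x \<in> {1..n} \<Longrightarrow> T (q k) x = eigenvalues_desc A ! k * q k x"
      "\<And>k l. k < n \<Longrightarrow> l < n \<Longrightarrow> k \<noteq> l \<Longrightarrow> local.ip (q k) (q l) = 0"
      "\<And>f. in_span p' n f \<Longrightarrow> in_span q n f"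
    by (rule orthogonal_eigenbasis[of T "\<lambda>x y. A $$ (x - 1, y - 1)" n p' "\<lambda>k. eigenvalues_desc A ! k"])
      (use T_def sym tri indep in auto)
  show thesis
  proof (rule that)
    show "ip (q k) (q k) > 0" if "k < n" for k using q(1)[OF that] unfolding ip_eq .
    show "(\<Sum>y\<in>{1..n}. A $$ (x - 1, y - 1) * q k y) = eigenvalues_desc A ! k * q k x"
      if "k < n" "x \<in> {1..n}" for k x
      using q(2)[OF that] by (simp add: T_def)
    show "ip (q k) (q l) = 0" if "k < n" "l < n" "k \<noteq> l" for k l
      using q(3)[OF that] unfolding ip_eq .
    show "\<exists>c. \<forall>x\<in>{1..n}. f x = (\<Sum>l<n. c l * q l x)" for f
      using q(4)[OF full] unfolding in_span_def .
  qed
qed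

section \<open>Poincare inequality for the canonical chain\<close>

definition pairs :: "nat \<Rightarrow> nat set set" where
  "pairs n = {{x, y} | x y. x \<in> {1..n} \<and> y \<in> {1..n} \<and> x \<noteq> y}"

locale pair_sampling =
  fixes n :: nat and D :: "nat pmf" and Q :: "nat set pmf"
  assumes set_D: "set_pmf D = {1..n}" and pair_Q: "pair_distribution n Q"
begin

declare One_nat_def [simp del]

lemma D_pos: "x \<in> {1..n} \<Longrightarrow> pmf D x > 0"
  using set_D by (simp add: pmf_positive_iff)

sublocale weighted_space "{1..n}" "pmf D"
  by standard (auto intro: D_pos)

lemma sum_D: "(\<Sum>x\<in>{1..n}. pmf D x) = 1"
  using set_D by (intro sum_pmf_eq_1) auto

lemma finite_pairs: "finite (pairs n)"
  by (rule finite_subset[of _ "Pow {1..n}"]) (auto simp: pairs_def)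

lemma sum_Q: "(\<Sum>e\<in>pairs n. pmf Q e) = 1"
  using pair_Q unfolding pair_distribution_def pairs_def[symmetric]
  by (intro sum_pmf_eq_1 finite_pairs)

lemma pairsI: "a \<in> {1..n} \<Longrightarrow> b \<in> {1..n} \<Longrightarrow> a \<noteq> b \<Longrightarrow> {a, b} \<in> pairs n"
  unfolding pairs_def by blast

lemma two_le_n: "n \<ge> 2"
proof -
  obtain e where "e \<in> set_pmf Q" using set_pmf_not_empty[of Q] by blast
  then obtain x y where "x \<in> {1..n}" "y \<in> {1..n}" "x \<noteq> y"
    using pair_Q unfolding pair_distribution_def by blast
  then show ?thesis by auto
qed

text \<open>For a pair \<open>e\<close> this is the conditional expectation under \<open>D\<close>
  when the points of \<open>e\<close> are identified, hence an orthogonal projection.\<close>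

definition avg :: "nat set \<Rightarrow> (nat \<Rightarrow> real) \<Rightarrow> nat \<Rightarrow> real" where
  "avg e f x = (if x \<in> e then (\<Sum>z\<in>e. pmf D z * f z) / (\<Sum>z\<in>e. pmf D z) else f x)"

text \<open>The squared norm lost under \<open>avg e\<close>; \<open>energy_pair\<close> shows that
  it is the Dirichlet form of the single edge \<open>e\<close>.\<close>

definition energy :: "nat set \<Rightarrow> (nat \<Rightarrow> real) \<Rightarrow> real" where
  "energy e f = ip f f - ip (avg e f) (avg e f)"

definition kernel :: "nat \<Rightarrow> nat \<Rightarrow> real" where
  "kernel x y = canonical_matrix n Q D $$ (x - 1, y - 1)"

lemma kernel_off_diagonal:
  assumes "x \<in> {1..n}" "y \<in> {1..n}" "x \<noteq> y"
  shows "kernel x y = pmf Q {x, y} * (pmf D y / (pmf D x + pmf D y))"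
  using assms unfolding kernel_def canonical_matrix_def Let_def by auto

lemma kernel_diagonal:
  assumes "x \<in> {1..n}"
  shows "kernel x x = 1 - (\<Sum>y\<in>{1..n} - {x}. kernel x y)"
proof -
  have "kernel x x = 1 - (\<Sum>y\<in>{1..n} - {x}. pmf Q {x, y} * (pmf D y / (pmf D x + pmf D y)))"
    using assms unfolding kernel_def canonical_matrix_def Let_def by auto
  also have "(\<Sum>y\<in>{1..n} - {x}. pmf Q {x, y} * (pmf D y / (pmf D x + pmf D y))) =
      (\<Sum>y\<in>{1..n} - {x}. kernel x y)"
    by (rule sum.cong) (use assms kernel_off_diagonal in auto)
  finally show ?thesis .
qed

lemma kernel_reversible:
  assumes "x \<in> {1..n}" "y \<in> {1..n}"
  shows "pmf D x * kernel x y = pmf D y * kernel y x"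
  using assms by (cases "x = y") (auto simp: kernel_off_diagonal insert_commute add.commute)

lemma avg_pair:
  assumes "a \<noteq> b"
  shows "avg {a, b} f x =
    (if x \<in> {a, b} then (pmf D a * f a + pmf D b * f b) / (pmf D a + pmf D b) else f x)"
  using assms by (simp add: avg_def)

text \<open>Row sums 1 turn the left side into \<open>f x\<close> plus weighted increments
  \<open>f y - f x\<close>. With the off-diagonal entry as weight, each is
  \<open>pmf Q {x, y}\<close> times the change of \<open>f x\<close> by averaging over
  \<open>{x, y}\<close>; pairs that miss \<open>x\<close> change nothing there.\<close>

lemma kernel_apply:
  assumes x: "x \<in> {1..n}"
  shows "(\<Sum>y\<in>{1..n}. kernel x y * f y) = (\<Sum>e\<in>pairs n. pmf Q e * avg e f x)"
proof -
  have "(\<Sum>y\<in>{1..n}. kernel x y * f y) = kernel x x * f x + (\<Sum>y\<in>{1..n} - {x}. kernel x y * f y)"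
    using x by (simp add: sum.remove)
  also have "\<dots> = f x + (\<Sum>y\<in>{1..n} - {x}. kernel x y * (f y - f x))"
  proof -
    have "(\<Sum>y\<in>{1..n} - {x}. kernel x y * (f y - f x)) =
        (\<Sum>y\<in>{1..n} - {x}. kernel x y * f y) - (\<Sum>y\<in>{1..n} - {x}. kernel x y) * f x"
      by (simp add: right_diff_distrib sum_subtractf sum_distrib_right)
    moreover have "kernel x x * f x = f x - (\<Sum>y\<in>{1..n} - {x}. kernel x y) * f x"
      unfolding kernel_diagonal[OF x] by (simp add: left_diff_distrib)
    ultimately show ?thesis by linarith
  qed
  also have "(\<Sum>y\<in>{1..n} - {x}. kernel x y * (f y - f x)) =
      (\<Sum>y\<in>{1..n} - {x}. pmf Q {x, y} * (avg {x, y} f x - f x))"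
  proof (rule sum.cong[OF refl])
    fix y assume y: "y \<in> {1..n} - {x}"
    then have "pmf D x > 0" "pmf D y > 0" using x D_pos by auto
    then have "avg {x, y} f x - f x = pmf D y / (pmf D x + pmf D y) * (f y - f x)"
      using y by (simp add: avg_pair field_simps)
    then show "kernel x y * (f y - f x) = pmf Q {x, y} * (avg {x, y} f x - f x)"
      using y x by (simp add: kernel_off_diagonal)
  qed
  also have "\<dots> = (\<Sum>e\<in>(\<lambda>y. {x, y}) ` ({1..n} - {x}). pmf Q e * (avg e f x - f x))"
    by (subst sum.reindex) (auto simp: inj_on_def doubleton_eq_iff)
  also have "\<dots> = (\<Sum>e\<in>pairs n. pmf Q e * (avg e f x - f x))"
  proof (rule sum.mono_neutral_left[OF finite_pairs])
    show "(\<lambda>y. {x, y}) ` ({1..n} - {x}) \<subseteq> pairs n" using x by (auto intro: pairsI)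
    show "\<forall>e\<in>pairs n - (\<lambda>y. {x, y}) ` ({1..n} - {x}). pmf Q e * (avg e f x - f x) = 0"
    proof
      fix e assume e: "e \<in> pairs n - (\<lambda>y. {x, y}) ` ({1..n} - {x})"
      then obtain a b where ab: "e = {a, b}" "a \<in> {1..n}" "b \<in> {1..n}" "a \<noteq> b"
        unfolding pairs_def by blast
      have "x \<notin> e"
      proof
        assume "x \<in> e"
        then consider "x = a" | "x = b" using ab by blast
        then show False
        proof cases
          case 1 then show False using e ab by blast
        next
          case 2
          then have "e = {x, a}" using ab by blast
          then show False using e ab 2 by blast
        qed
      qed
      then show "pmf Q e * (avg e f x - f x) = 0" by (simp add: avg_def)
    qed
  qed
  also have "\<dots> = (\<Sum>e\<in>pairs n. pmf Q e * avg e f x) - f x"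
    using sum_Q by (simp add: algebra_simps sum_subtractf sum_distrib_left[symmetric])
  finally show ?thesis by simp
qed

lemma sum_remove_pair:
  fixes h :: "nat \<Rightarrow> real"
  assumes "a \<in> {1..n}" "b \<in> {1..n}" "a \<noteq> b"
  shows "(\<Sum>x\<in>{1..n}. h x) = h a + h b + (\<Sum>x\<in>{1..n} - {a, b}. h x)"
proof -
  have "(\<Sum>x\<in>{1..n}. h x) = (\<Sum>x\<in>{a, b}. h x) + (\<Sum>x\<in>{1..n} - {a, b}. h x)"
    using assms by (subst sum.subset_diff[of "{a, b}"]) auto
  then show ?thesis using assms(3) by simp
qed

lemma ip_remove_pair:
  assumes "a \<in> {1..n}" "b \<in> {1..n}" "a \<noteq> b"
  shows "ip f g = pmf D a * f a * g a + pmf D b * f b * g b + (\<Sum>x\<in>{1..n} - {a, b}. pmf D x * f x * g x)"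
  unfolding ip_def by (rule sum_remove_pair[OF assms])

lemma avg_rest: "(\<Sum>x\<in>{1..n} - e. h x (avg e f x)) = (\<Sum>x\<in>{1..n} - e. h x (f x))"
  by (rule sum.cong) (auto simp: avg_def)

text \<open>\<open>avg e\<close> is self-adjoint and idempotent. Concretely, on \<open>e\<close> the
  weighted sum of \<open>f\<close> is the total weight times the mean \<open>m\<close>, and off
  \<open>e\<close> nothing changes.\<close>

lemma ip_avg:
  assumes "e \<in> pairs n"
  shows "ip f (avg e f) = ip (avg e f) (avg e f)"
proof -
  obtain a b where ab: "e = {a, b}" "a \<in> {1..n}" "b \<in> {1..n}" "a \<noteq> b"
    using assms unfolding pairs_def by blast
  define m where "m = (pmf D a * f a + pmf D b * f b) / (pmf D a + pmf D b)"
  have "pmf D a + pmf D b > 0" using D_pos[OF ab(2)] D_pos[OF ab(3)] by simp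
  then have m: "pmf D a * f a + pmf D b * f b = (pmf D a + pmf D b) * m"
    by (simp add: m_def)
  have av: "avg e f a = m" "avg e f b = m" using ab by (auto simp: avg_pair m_def)
  have "pmf D a * f a * m + pmf D b * f b * m = pmf D a * m * m + pmf D b * m * m"
    using arg_cong[OF m, of "\<lambda>t. t * m"] by (simp add: algebra_simps)
  then show ?thesis
    unfolding ip_remove_pair[OF ab(2-4)] av ab(1)[symmetric]
    using avg_rest[where h = "\<lambda>x t. pmf D x * f x * t" and f = f and e = e]
      avg_rest[where h = "\<lambda>x t. pmf D x * t * t" and f = f and e = e] by simp
qed

lemma energy_pair_mean:
  fixes f :: "nat \<Rightarrow> real"
  assumes "a \<in> {1..n}" "b \<in> {1..n}" "a \<noteq> b"
  defines "m \<equiv> (pmf D a * f a + pmf D b * f b) / (pmf D a + pmf D b)"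
  shows "energy {a, b} f = pmf D a * (f a)\<^sup>2 + pmf D b * (f b)\<^sup>2 - (pmf D a + pmf D b) * m\<^sup>2"
proof -
  have av: "avg {a, b} f a = m" "avg {a, b} f b = m" using assms by (auto simp: avg_pair m_def)
  show ?thesis
    unfolding energy_def ip_remove_pair[OF assms(1-3)] av
    using avg_rest[where h = "\<lambda>x t. pmf D x * t * t" and f = f and e = "{a, b}"]
    by (simp add: algebra_simps power2_eq_square)
qed

lemma energy_pair:
  assumes "a \<in> {1..n}" "b \<in> {1..n}" "a \<noteq> b"
  shows "energy {a, b} f = pmf D a * pmf D b / (pmf D a + pmf D b) * (f a - f b)\<^sup>2"
proof -
  define m where "m = (pmf D a * f a + pmf D b * f b) / (pmf D a + pmf D b)"
  have pos: "pmf D a + pmf D b > 0" using D_pos[OF assms(1)] D_pos[OF assms(2)] by simp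
  have m: "(pmf D a + pmf D b) * m = pmf D a * f a + pmf D b * f b"
    using pos by (simp add: m_def)
  \<comment> \<open>Multiplying by the total weight clears the denominator hidden in the mean
    \<open>m\<close>.\<close>
  have "(pmf D a + pmf D b) * energy {a, b} f =
      (pmf D a + pmf D b) * (pmf D a * (f a)\<^sup>2 + pmf D b * (f b)\<^sup>2)
      - ((pmf D a + pmf D b) * m) * ((pmf D a + pmf D b) * m)"
    unfolding energy_pair_mean[OF assms] m_def[symmetric]
    by (simp add: algebra_simps power2_eq_square)
  also have "\<dots> = pmf D a * pmf D b * (f a - f b)\<^sup>2"
    unfolding m by (simp add: algebra_simps power2_eq_square)
  finally show ?thesis using pos by (simp add: field_simps)
qed

lemma energy_nonneg:
  assumes "e \<in> pairs n"
  shows "energy e f \<ge> 0"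
  using assms unfolding pairs_def by (auto simp: energy_pair)

lemma energy_shift:
  assumes "e \<in> pairs n"
  shows "energy e (\<lambda>x. f x - c) = energy e f"
  using assms unfolding pairs_def by (auto simp: energy_pair)

text \<open>The quadratic form of the chain is a mixture of squared norms, hence nonnegative; this
  later rules out negative eigenvalues.\<close>

lemma ip_kernel:
  "ip f (\<lambda>x. \<Sum>y\<in>{1..n}. kernel x y * f y) = (\<Sum>e\<in>pairs n. pmf Q e * ip (avg e f) (avg e f))"
proof -
  have "ip f (\<lambda>x. \<Sum>y\<in>{1..n}. kernel x y * f y) = ip f (\<lambda>x. \<Sum>e\<in>pairs n. pmf Q e * avg e f x)"
    by (rule ip_cong[OF refl]) (rule kernel_apply)
  also have "\<dots> = (\<Sum>e\<in>pairs n. pmf Q e * ip f (avg e f))"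
    unfolding ip_def sum_distrib_left by (subst sum.swap) (simp add: mult_ac)
  finally show ?thesis by (simp add: ip_avg)
qed

lemma ip_kernel_energy:
  "ip f (\<lambda>x. \<Sum>y\<in>{1..n}. kernel x y * f y) = ip f f - (\<Sum>e\<in>pairs n. pmf Q e * energy e f)"
  unfolding ip_kernel energy_def
  by (simp add: right_diff_distrib sum_subtractf sum_Q flip: sum_distrib_right)

text \<open>The quadratic form at an eigenfunction, read in two ways. For a function of positive
  norm the first identity forces \<open>0 \<le> c\<close> and the second
  \<open>c \<le> 1\<close>.\<close>

lemma eigenvalue_energy:
  assumes "\<And>x. x \<in> {1..n} \<Longrightarrow> (\<Sum>y\<in>{1..n}. kernel x y * f y) = c * f x"
  shows "c * ip f f = (\<Sum>e\<in>pairs n. pmf Q e * ip (avg e f) (avg e f))"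
    and "(1 - c) * ip f f = (\<Sum>e\<in>pairs n. pmf Q e * energy e f)"
proof -
  have "ip f (\<lambda>x. \<Sum>y\<in>{1..n}. kernel x y * f y) = ip (\<lambda>x. c * f x) f"
    unfolding ip_commute[of "\<lambda>x. c * f x"] by (rule ip_cong) (use assms in auto)
  then have *: "ip f (\<lambda>x. \<Sum>y\<in>{1..n}. kernel x y * f y) = c * ip f f"
    by (simp add: ip_scale_left)
  from * show "c * ip f f = (\<Sum>e\<in>pairs n. pmf Q e * ip (avg e f) (avg e f))"
    by (simp add: ip_kernel)
  from * show "(1 - c) * ip f f = (\<Sum>e\<in>pairs n. pmf Q e * energy e f)"
    unfolding ip_kernel_energy by (simp add: left_diff_distrib)
qed

text \<open>Rows sum to 1, so detailed balance makes \<open>D\<close> stationary. Consequently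
  eigenfunctions with eigenvalue other than 1 are orthogonal to the constants.\<close>

lemma kernel_stationary:
  "ip (\<lambda>x. \<Sum>y\<in>{1..n}. kernel x y * f y) (\<lambda>_. 1) = ip f (\<lambda>_. 1)"
proof -
  have row: "(\<Sum>x\<in>{1..n}. kernel y x) = 1" if "y \<in> {1..n}" for y
    using that kernel_diagonal[OF that] sum.remove[of "{1..n}" y "kernel y"] by simp
  have "ip (\<lambda>x. \<Sum>y\<in>{1..n}. kernel x y * f y) (\<lambda>_. 1) =
      (\<Sum>x\<in>{1..n}. \<Sum>y\<in>{1..n}. (pmf D x * kernel x y) * f y)"
    unfolding ip_def by (simp add: sum_distrib_left mult_ac)
  also have "\<dots> = (\<Sum>x\<in>{1..n}. \<Sum>y\<in>{1..n}. (pmf D y * kernel y x) * f y)"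
    by (intro sum.cong refl) (simp only: kernel_reversible)
  also have "\<dots> = (\<Sum>y\<in>{1..n}. pmf D y * f y * (\<Sum>x\<in>{1..n}. kernel y x))"
    by (subst sum.swap) (simp add: sum_distrib_left mult_ac)
  also have "\<dots> = ip f (\<lambda>_. 1)"
    unfolding ip_def by (rule sum.cong) (simp_all add: row)
  finally show ?thesis .
qed

end

section \<open>Connectivity and the spectral gap\<close>

locale connected_pair_sampling = pair_sampling +
  assumes connected: "Digraph_Component.connected (with_proj (induced_graph n Q))"
begin

text \<open>Equality propagates along a path. The library notion of connectedness passes to the
  symmetric closure, whose arcs still correspond to edges because \<open>{u, v}\<close> is
  unordered.\<close>

lemma constant_if_edges:
  assumes edge: "\<And>a b. a \<in> {1..n} \<Longrightarrow> b \<in> {1..n} \<Longrightarrow> a \<noteq> b \<Longrightarrow> pmf Q {a, b} > 0 \<Longrightarrow> f a = f b"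
    and "x \<in> {1..n}" "y \<in> {1..n}"
  shows "f x = f y"
proof -
  let ?G = "with_proj (mk_symmetric (with_proj (induced_graph n Q)))"
  have "x \<rightarrow>\<^sup>*\<^bsub>?G\<^esub> y"
    using connected assms(2,3)
    by (auto simp: Digraph_Component.connected_def strongly_connected_def induced_graph_def)
  then have "(x, y) \<in> (arcs_ends ?G)\<^sup>*" by (rule reachable_rtranclI)
  then show ?thesis
  proof (induction rule: rtrancl_induct)
    case base
    then show ?case by simp
  next
    case (step u v)
    then have "u \<in> {1..n} \<and> v \<in> {1..n} \<and> u \<noteq> v \<and> pmf Q {u, v} > 0"
      by (auto simp: parcs_mk_symmetric induced_graph_def insert_commute)
    with edge[of u v] step.IH show ?case by simp
  qed
qed

abbreviation "\<Gamma> \<equiv> absolute_spectral_gap (canonical_matrix n Q D)"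

lemma energy_0_constant:
  assumes "(\<Sum>e\<in>pairs n. pmf Q e * energy e f) = 0" "x \<in> {1..n}" "y \<in> {1..n}"
  shows "f x = f y"
proof (rule constant_if_edges)
  fix a b assume ab: "a \<in> {1..n}" "b \<in> {1..n}" "a \<noteq> b" "pmf Q {a, b} > 0"
  have "{a, b} \<in> pairs n" using ab by (intro pairsI)
  then have "pmf Q {a, b} * energy {a, b} f = 0"
    using assms(1) finite_pairs energy_nonneg
    by (subst (asm) sum_nonneg_eq_0_iff) auto
  then show "f a = f b"
    using ab D_pos[OF ab(1)] D_pos[OF ab(2)] by (simp add: energy_pair)
qed fact+

text \<open>One orthogonal eigenbasis serves all three claims: eigenvalues lie in [0, 1],
  connectivity leaves only the constants for eigenvalue 1, and a centred \<open>f\<close> has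
  components only from the second eigenvalue on.\<close>

lemma spectral_gap:
  shows spectral_gap_pos: "0 < \<Gamma>"
    and spectral_gap_le_1: "\<Gamma> \<le> 1"
    and poincare_centered: "ip f (\<lambda>_. 1) = 0 \<Longrightarrow>
      \<Gamma> * ip f f \<le> (\<Sum>e\<in>pairs n. pmf Q e * energy e f)"
proof -
  let ?A = "canonical_matrix n Q D"
  let ?ev = "eigenvalues_desc ?A"
  have car: "?A \<in> carrier_mat n n" by (simp add: canonical_matrix_def Let_def)
  have rev: "pmf D x * ?A $$ (x - 1, y - 1) = pmf D y * ?A $$ (y - 1, x - 1)"
    if "x \<in> {1..n}" "y \<in> {1..n}" for x y
    using kernel_reversible[OF that] by (simp add: kernel_def)
  obtain q where q: "\<And>k. k < n \<Longrightarrow> ip (q k) (q k) > 0"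
      "\<And>k x. k < n \<Longrightarrow> x \<in> {1..n} \<Longrightarrow>
        (\<Sum>y\<in>{1..n}. ?A $$ (x - 1, y - 1) * q k y) = ?ev ! k * q k x"
      "\<And>k l. k < n \<Longrightarrow> l < n \<Longrightarrow> k \<noteq> l \<Longrightarrow> ip (q k) (q l) = 0"
      "\<And>f. \<exists>c. \<forall>x\<in>{1..n}. f x = (\<Sum>l<n. c l * q l x)"
    by (rule reversible_eigenbasis[OF car D_pos rev]) (assumption | rule that)+
  note q = q(1) q(2)[folded kernel_def] q(3,4)
  have sorted: "sorted_wrt (\<ge>) ?ev" and len: "length ?ev = n"
  proof -
    have *: "pmf D (Suc i) * ?A $$ (i, j) = pmf D (Suc j) * ?A $$ (j, i)" if "i < n" "j < n" for i j
      using rev[of "Suc i" "Suc j"] that by (simp add: One_nat_def)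
    have "pmf D (Suc i) > 0" if "i < n" for i
      using D_pos[of "Suc i"] that by (simp add: One_nat_def)
    from reversible_eigenvalues_desc(2,3)[of ?A n "\<lambda>i. pmf D (Suc i)", OF car this *]
    show "sorted_wrt (\<ge>) ?ev" "length ?ev = n" by auto
  qed
  have mono: "?ev ! l \<le> ?ev ! k" if "k \<le> l" "l < n" for k l
    using sorted_wrt_nth_less[OF sorted, of k l] that len by (cases "k = l") auto
  have en: "?ev ! k * ip (q k) (q k) = (\<Sum>e\<in>pairs n. pmf Q e * ip (avg e (q k)) (avg e (q k)))"
      "(1 - ?ev ! k) * ip (q k) (q k) = (\<Sum>e\<in>pairs n. pmf Q e * energy e (q k))" if "k < n" for k
    using eigenvalue_energy[of "q k" "?ev ! k", OF q(2)[OF that]] by auto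
  have bound: "?ev ! k \<ge> 0" "?ev ! k \<le> 1" if k: "k < n" for k
  proof -
    have "?ev ! k * ip (q k) (q k) \<ge> 0"
      unfolding en(1)[OF k] by (intro sum_nonneg mult_nonneg_nonneg ip_self_nonneg) simp
    then show "?ev ! k \<ge> 0" using q(1)[OF k] by (simp add: zero_le_mult_iff)
    have "(1 - ?ev ! k) * ip (q k) (q k) \<ge> 0"
      unfolding en(2)[OF k] by (intro sum_nonneg mult_nonneg_nonneg energy_nonneg) simp
    then show "?ev ! k \<le> 1" using q(1)[OF k] by (simp add: zero_le_mult_iff)
  qed
  have const: "q k x = q k 1" if "k < n" "?ev ! k = 1" "x \<in> {1..n}" for k x
  proof (rule energy_0_constant)
    show "(\<Sum>e\<in>pairs n. pmf Q e * energy e (q k)) = 0"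
      using en(2)[OF that(1)] unfolding that(2) by simp
  qed (use that two_le_n in auto)
  have ip_const: "ip (q k) f = q k 1 * ip f (\<lambda>_. 1)" if "k < n" "?ev ! k = 1" for k f
  proof -
    have "ip (q k) f = ip (\<lambda>x. q k 1 * 1) f"
    proof (rule ip_cong)
      show "q k x = q k 1 * 1" if "x \<in> {1..n}" for x
        using const[OF \<open>k < n\<close> \<open>?ev ! k = 1\<close> that] by (simp only: mult_1_right)
    qed simp
    then show ?thesis by (simp only: ip_scale_left) (simp add: ip_commute)
  qed
  have one: "ip (\<lambda>_. 1) (\<lambda>_. 1) = 1" using sum_D by (simp add: ip_def)
  \<comment> \<open>If 1 were not an eigenvalue, stationarity would make every basis function
    orthogonal to the constant 1, which is a combination of them.\<close>
  have ev0: "?ev ! 0 = 1"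
  proof (rule ccontr)
    assume "?ev ! 0 \<noteq> 1"
    then have ne: "?ev ! k \<noteq> 1" if "k < n" for k
      using mono[of 0 k] bound[of 0] that by force
    have zero: "ip (\<lambda>_. 1) (q k) = 0" if k: "k < n" for k
    proof -
      have "ip (q k) (\<lambda>_. 1) = ip (\<lambda>x. \<Sum>y\<in>{1..n}. kernel x y * q k y) (\<lambda>_. 1)"
        by (simp only: kernel_stationary)
      also have "\<dots> = ip (\<lambda>x. ?ev ! k * q k x) (\<lambda>_. 1)"
        by (rule ip_cong) (use q(2)[OF k] in auto)
      also have "\<dots> = ?ev ! k * ip (q k) (\<lambda>_. 1)" by (rule ip_scale_left)
      finally show ?thesis using ne[OF k] by (simp add: ip_commute)
    qed
    obtain c where c: "\<forall>x\<in>{1..n}. 1 = (\<Sum>l<n. c l * q l x)" using q(4)[of "\<lambda>_. 1"] by auto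
    have "ip (\<lambda>_. 1) (\<lambda>_. 1) = ip (\<lambda>_. 1) (\<lambda>x. \<Sum>l<n. c l * q l x)"
      by (rule ip_cong) (use c in auto)
    then show False using one zero by (simp add: ip_sum_right)
  qed
  \<comment> \<open>With two eigenvalues 1, the functions \<open>q 0\<close> and \<open>q 1\<close>
    would be nonzero constants on [n], yet orthogonal.\<close>
  have ev1: "?ev ! 1 < 1"
  proof (rule ccontr)
    assume "\<not> ?ev ! 1 < 1"
    then have "?ev ! 1 = 1" using bound[of 1] two_le_n by simp
    then have "ip (q 1) (\<lambda>_. 1) = q 1 1" using ip_const[of 1 "\<lambda>_. 1"] one two_le_n by simp
    moreover have "ip (q 0) (q 1) = 0" using q(3)[of 0 1] two_le_n by simp
    ultimately have "q 0 1 * q 1 1 = 0"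
      using ip_const[of 0 "q 1"] ev0 two_le_n by simp
    moreover have "ip (q k) (q k) = q k 1 * q k 1" if "k < n" "?ev ! k = 1" for k
      using ip_const[OF that, of "q k"] ip_const[OF that, of "\<lambda>_. 1"] one by simp
    ultimately show False
      using q(1)[of 0] q(1)[of 1] ev0 \<open>?ev ! 1 = 1\<close> two_le_n by force
  qed
  \<comment> \<open>Eigenvalues are nonnegative and decreasing, so the absolute value of the last
    one never exceeds the second, found at position 1.\<close>
  have gap: "\<Gamma> = 1 - ?ev ! 1"
    unfolding absolute_spectral_gap_def Let_def
    using car bound[of "n - 1"] mono[of 1 "n - 1"] two_le_n by (auto simp: max_def)
  show "0 < \<Gamma>" using gap ev1 by simp
  show "\<Gamma> \<le> 1" using gap bound[of 1] two_le_n by simp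
  assume f: "ip f (\<lambda>_. 1) = 0"
  obtain c where c: "\<forall>x\<in>{1..n}. f x = (\<Sum>l<n. c l * q l x)" using q(4)[of f] by auto
  \<comment> \<open>The basis is orthogonal but not normalised: \<open>d l\<close> is the inner
    product of \<open>f\<close> with \<open>q l\<close>, and \<open>c l * d l\<close> is the squared
    norm of that component.\<close>
  define d where "d l = c l * ip (q l) (q l)" for l
  have ipq: "ip f (q l) = d l" if "l < n" for l
  proof -
    have "ip f (q l) = ip (\<lambda>x. \<Sum>l<n. c l * q l x) (q l)" by (rule ip_cong) (use c in auto)
    also have "\<dots> = (\<Sum>m<n. if m = l then d l else 0)"
      unfolding ip_sum_left by (rule sum.cong) (use q(3) that in \<open>auto simp: d_def\<close>)
    finally show ?thesis using that by simp
  qed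
  \<comment> \<open>\<open>q 0\<close> is constant on [n], so a centred \<open>f\<close> has no
    component along it.\<close>
  have d0: "d 0 = 0"
    using ipq[of 0] ip_const[of 0 f] ev0 f two_le_n by (simp add: ip_commute)
  have ff: "ip f f = (\<Sum>l<n. c l * d l)"
  proof -
    have "ip f f = ip f (\<lambda>x. \<Sum>l<n. c l * q l x)" by (rule ip_cong) (use c in auto)
    then show ?thesis by (simp add: ip_sum_right ipq)
  qed
  have fMf: "ip f (\<lambda>x. \<Sum>y\<in>{1..n}. kernel x y * f y) = (\<Sum>l<n. (c l * ?ev ! l) * d l)"
  proof -
    have "(\<Sum>y\<in>{1..n}. kernel x y * f y) = (\<Sum>l<n. (c l * ?ev ! l) * q l x)" if x: "x \<in> {1..n}" for x
    proof -
      have "(\<Sum>y\<in>{1..n}. kernel x y * f y) = (\<Sum>y\<in>{1..n}. \<Sum>l<n. c l * (kernel x y * q l y))"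
        by (rule sum.cong) (use c in \<open>auto simp: sum_distrib_left mult_ac\<close>)
      also have "\<dots> = (\<Sum>l<n. c l * (\<Sum>y\<in>{1..n}. kernel x y * q l y))"
        by (subst sum.swap) (simp add: sum_distrib_left)
      also have "\<dots> = (\<Sum>l<n. (c l * ?ev ! l) * q l x)"
        by (rule sum.cong) (use q(2) x in auto)
      finally show ?thesis .
    qed
    then have "ip f (\<lambda>x. \<Sum>y\<in>{1..n}. kernel x y * f y) = ip f (\<lambda>x. \<Sum>l<n. (c l * ?ev ! l) * q l x)"
      by (intro ip_cong) auto
    then show ?thesis by (simp add: ip_sum_right ipq)
  qed
  have "ip f (\<lambda>x. \<Sum>y\<in>{1..n}. kernel x y * f y) \<le> (\<Sum>l<n. ?ev ! 1 * (c l * d l))"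
    unfolding fMf
  proof (rule sum_mono)
    fix l assume l: "l \<in> {..<n}"
    show "c l * ?ev ! l * d l \<le> ?ev ! 1 * (c l * d l)"
    proof (cases "l = 0")
      case False
      then have "?ev ! l \<le> ?ev ! 1" using mono[of 1 l] l by simp
      moreover have "c l * d l \<ge> 0"
        using ip_self_nonneg[of "q l"] by (simp add: d_def flip: mult.assoc)
      ultimately show ?thesis using mult_right_mono[of "?ev ! l" "?ev ! 1" "c l * d l"] by (simp add: mult_ac)
    qed (simp add: d0)
  qed
  also have "\<dots> = ?ev ! 1 * ip f f" by (simp add: ff sum_distrib_left)
  finally show "\<Gamma> * ip f f \<le> (\<Sum>e\<in>pairs n. pmf Q e * energy e f)"
    unfolding ip_kernel_energy gap by (simp add: algebra_simps)
qed

text \<open>Centring \<open>f\<close> leaves every edge energy unchanged and lowers the squared norm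
  by the square of the mean.\<close>

lemma poincare:
  "\<Gamma> * (ip f f - (ip f (\<lambda>_. 1))\<^sup>2) \<le> (\<Sum>e\<in>pairs n. pmf Q e * energy e f)"
proof -
  define m where "m = ip f (\<lambda>_. 1)"
  have one: "ip (\<lambda>_. m) g = m * ip g (\<lambda>_. 1)" for g
    using ip_scale_left[of m "\<lambda>_. 1" g] by (simp add: ip_commute)
  have unit: "ip (\<lambda>_. 1) (\<lambda>_. 1) = 1" using sum_D by (simp add: ip_def)
  have "ip (\<lambda>x. f x - m) (\<lambda>_. 1) = 0"
    by (simp add: unit ip_diff_left one m_def[symmetric])
  from poincare_centered[OF this]
  have "\<Gamma> * ip (\<lambda>x. f x - m) (\<lambda>x. f x - m) \<le> (\<Sum>e\<in>pairs n. pmf Q e * energy e f)"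
    by (simp add: energy_shift)
  moreover have "ip (\<lambda>x. f x - m) (\<lambda>x. f x - m) = ip f (\<lambda>x. f x - m) - m * ip (\<lambda>x. f x - m) (\<lambda>_. 1)"
    by (simp only: ip_diff_left[of f "\<lambda>_. m"] one)
  ultimately show ?thesis
    using \<open>ip (\<lambda>x. f x - m) (\<lambda>_. 1) = 0\<close>
    by (simp add: ip_commute[of f "\<lambda>x. f x - m"] ip_diff_left one unit m_def[symmetric] power2_eq_square)
qed

end

section \<open>Contraction for a pair of walkers\<close>

text \<open>Nonnegativity of the variance around the mean \<open>m\<close>.\<close>

lemma square_of_weighted_sum_le:
  fixes p v :: "'a \<Rightarrow> real"
  assumes "\<And>x. x \<in> S \<Longrightarrow> p x \<ge> 0" "(\<Sum>x\<in>S. p x) = 1"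
  shows "(\<Sum>x\<in>S. p x * v x)\<^sup>2 \<le> (\<Sum>x\<in>S. p x * (v x)\<^sup>2)"
proof -
  define m where "m = (\<Sum>x\<in>S. p x * v x)"
  have "0 \<le> (\<Sum>x\<in>S. p x * (v x - m)\<^sup>2)"
    using assms(1) by (intro sum_nonneg) simp
  also have "\<dots> = (\<Sum>x\<in>S. p x * (v x)\<^sup>2 - 2 * m * (p x * v x) + m\<^sup>2 * p x)"
    by (rule sum.cong) (simp_all add: power2_eq_square algebra_simps)
  also have "\<dots> = (\<Sum>x\<in>S. p x * (v x)\<^sup>2) - 2 * m * m + m\<^sup>2"
    using assms(2) by (simp add: sum.distrib sum_subtractf m_def flip: sum_distrib_left)
  finally show ?thesis by (simp add: m_def[symmetric] power2_eq_square)
qed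

section \<open>Two walkers driven by a common winner\<close>

context pair_sampling
begin

text \<open>For \<open>z\<close> in \<open>e\<close> this is the map of one oracle answer: the loser
  goes to \<open>z\<close> and the winner stays.\<close>

definition move :: "nat set \<Rightarrow> nat \<Rightarrow> nat \<Rightarrow> nat" where
  "move e z x = (if x \<in> e then z else x)"

text \<open>Both walkers follow the same winner, so they meet as soon as both lie in
  \<open>e\<close>.\<close>

definition pair_avg :: "nat set \<Rightarrow> (nat \<Rightarrow> nat \<Rightarrow> real) \<Rightarrow> nat \<Rightarrow> nat \<Rightarrow> real" where
  "pair_avg e u x y = (\<Sum>z\<in>e. pmf D z * u (move e z x) (move e z y)) / (\<Sum>z\<in>e. pmf D z)"

text \<open>The squared norm for the product measure, sliced by \<open>y\<close> so that
  one-coordinate results apply to each slice.\<close>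

definition pair_norm :: "(nat \<Rightarrow> nat \<Rightarrow> real) \<Rightarrow> real" where
  "pair_norm u = (\<Sum>y\<in>{1..n}. pmf D y * ip (\<lambda>x. u x y) (\<lambda>x. u x y))"

text \<open>For \<open>y\<close> outside \<open>e\<close> the slice is projected by
  \<open>avg e\<close> and loses its energy. The strips with \<open>y\<close> in \<open>e\<close>
  and \<open>x\<close> outside lose the same by symmetry, whence the 2. The block with both points
  in \<open>e\<close> becomes zero; by \<open>en_ab\<close> its loss is twice the weighted energy of
  the slices at \<open>a\<close> and \<open>b\<close>.\<close>

lemma pair_norm_pair_avg:
  assumes e: "e \<in> pairs n"
    and sym: "\<And>x y. u x y = u y x" and diag: "\<And>x. u x x = 0"
  shows "pair_norm (pair_avg e u) = pair_norm u - 2 * (\<Sum>y\<in>{1..n}. pmf D y * energy e (\<lambda>x. u x y))"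
proof -
  obtain a b where e_def: "e = {a, b}" and ab: "a \<in> {1..n}" "b \<in> {1..n}" "a \<noteq> b"
    using e unfolding pairs_def by blast
  let ?\<alpha> = "pmf D a" and ?\<beta> = "pmf D b" and ?R = "{1..n} - {a, b}"
  define m where "m y = (?\<alpha> * u a y + ?\<beta> * u b y) / (?\<alpha> + ?\<beta>)" for y
  have pos: "?\<alpha> > 0" "?\<beta> > 0" using D_pos ab by auto
  have v_out: "pair_avg e u x y = avg e (\<lambda>x. u x y) x" if "y \<notin> {a, b}" for x y
    using that ab(3) pos unfolding pair_avg_def avg_def move_def e_def
    by (auto simp flip: distrib_right)
  have v_in: "pair_avg e u x y = (if x \<in> {a, b} then 0 else m x)" if "y \<in> {a, b}" for x y
    using that ab(3) diag unfolding pair_avg_def avg_def move_def e_def m_def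
    by (auto simp: sym[of x])
  have en: "energy e (\<lambda>x. u x y) = ?\<alpha> * (u a y)\<^sup>2 + ?\<beta> * (u b y)\<^sup>2 - (?\<alpha> + ?\<beta>) * (m y)\<^sup>2" for y
    unfolding e_def m_def by (rule energy_pair_mean[OF ab])
  have norm_out: "ip (\<lambda>x. pair_avg e u x y) (\<lambda>x. pair_avg e u x y) =
      ip (\<lambda>x. u x y) (\<lambda>x. u x y) - energy e (\<lambda>x. u x y)" if "y \<in> ?R" for y
    using that by (simp add: v_out energy_def)
  have norm_in: "ip (\<lambda>x. pair_avg e u x y) (\<lambda>x. pair_avg e u x y) = (\<Sum>x\<in>?R. pmf D x * (m x)\<^sup>2)"
    if "y \<in> {a, b}" for y
    unfolding ip_remove_pair[OF ab]
    by (simp add: v_in[OF that] power2_eq_square mult.assoc cong: sum.cong_simp)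
  have ip_a: "ip (\<lambda>x. u x a) (\<lambda>x. u x a) = ?\<beta> * (u a b)\<^sup>2 + (\<Sum>x\<in>?R. pmf D x * (u a x)\<^sup>2)"
    unfolding ip_remove_pair[OF ab] by (simp add: diag power2_eq_square mult.assoc sym[of _ a])
  have ip_b: "ip (\<lambda>x. u x b) (\<lambda>x. u x b) = ?\<alpha> * (u a b)\<^sup>2 + (\<Sum>x\<in>?R. pmf D x * (u b x)\<^sup>2)"
    unfolding ip_remove_pair[OF ab] by (simp add: diag power2_eq_square mult.assoc sym[of _ b])
  have en_a: "(?\<alpha> + ?\<beta>) * energy e (\<lambda>x. u x a) = ?\<alpha> * ?\<beta> * (u a b)\<^sup>2"
    and en_b: "(?\<alpha> + ?\<beta>) * energy e (\<lambda>x. u x b) = ?\<alpha> * ?\<beta> * (u a b)\<^sup>2"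
    using pos unfolding e_def energy_pair[OF ab] by (simp_all add: diag sym[of b a])
  have en_ab: "?\<alpha> * energy e (\<lambda>x. u x a) + ?\<beta> * energy e (\<lambda>x. u x b) = ?\<alpha> * ?\<beta> * (u a b)\<^sup>2"
  proof -
    have "energy e (\<lambda>x. u x a) = energy e (\<lambda>x. u x b)"
      unfolding e_def energy_pair[OF ab] by (simp add: diag sym[of b a])
    with en_b show ?thesis by (simp add: distrib_right)
  qed
  have "pair_norm (pair_avg e u) =
      (?\<alpha> + ?\<beta>) * (\<Sum>x\<in>?R. pmf D x * (m x)\<^sup>2)
      + (\<Sum>y\<in>?R. pmf D y * (ip (\<lambda>x. u x y) (\<lambda>x. u x y) - energy e (\<lambda>x. u x y)))"
    unfolding pair_norm_def sum_remove_pair[OF ab]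
    by (simp add: norm_in[OF insertI1] norm_in[OF insertI2[OF singletonI]] norm_out distrib_right
        del: insert_iff cong: sum.cong_simp)
  also have "(?\<alpha> + ?\<beta>) * (\<Sum>x\<in>?R. pmf D x * (m x)\<^sup>2) =
      (\<Sum>y\<in>?R. pmf D y * (?\<alpha> * (u a y)\<^sup>2 + ?\<beta> * (u b y)\<^sup>2 - energy e (\<lambda>x. u x y)))"
    unfolding sum_distrib_left by (rule sum.cong) (simp_all add: en mult_ac)
  also have "\<dots> + (\<Sum>y\<in>?R. pmf D y * (ip (\<lambda>x. u x y) (\<lambda>x. u x y) - energy e (\<lambda>x. u x y))) =
      ?\<alpha> * (\<Sum>y\<in>?R. pmf D y * (u a y)\<^sup>2) + ?\<beta> * (\<Sum>y\<in>?R. pmf D y * (u b y)\<^sup>2)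
      + (\<Sum>y\<in>?R. pmf D y * ip (\<lambda>x. u x y) (\<lambda>x. u x y))
      - 2 * (\<Sum>y\<in>?R. pmf D y * energy e (\<lambda>x. u x y))"
    by (simp add: algebra_simps sum.distrib sum_subtractf sum_distrib_left)
  also have "\<dots> = pair_norm u - 2 * (\<Sum>y\<in>{1..n}. pmf D y * energy e (\<lambda>x. u x y))"
    unfolding pair_norm_def sum_remove_pair[OF ab] ip_a ip_b distrib_left
    using en_ab by (simp add: algebra_simps)
  finally show ?thesis .
qed

text \<open>Convexity of the square, applied pointwise with the probability weights
  \<open>pmf Q e\<close>.\<close>

lemma pair_norm_mix:
  "pair_norm (\<lambda>x y. \<Sum>e\<in>pairs n. pmf Q e * v e x y) \<le> (\<Sum>e\<in>pairs n. pmf Q e * pair_norm (v e))"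
proof -
  have "pair_norm (\<lambda>x y. \<Sum>e\<in>pairs n. pmf Q e * v e x y) =
      (\<Sum>y\<in>{1..n}. \<Sum>x\<in>{1..n}. pmf D y * pmf D x * (\<Sum>e\<in>pairs n. pmf Q e * v e x y)\<^sup>2)"
    unfolding pair_norm_def ip_def by (simp add: sum_distrib_left power2_eq_square mult_ac)
  also have "\<dots> \<le> (\<Sum>y\<in>{1..n}. \<Sum>x\<in>{1..n}. pmf D y * pmf D x * (\<Sum>e\<in>pairs n. pmf Q e * (v e x y)\<^sup>2))"
    by (intro sum_mono mult_left_mono square_of_weighted_sum_le sum_Q) simp_all
  also have "\<dots> = (\<Sum>y\<in>{1..n}. \<Sum>x\<in>{1..n}. \<Sum>e\<in>pairs n. pmf Q e * (pmf D y * (pmf D x * v e x y * v e x y)))"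
    by (simp add: sum_distrib_left power2_eq_square mult_ac)
  also have "\<dots> = (\<Sum>y\<in>{1..n}. \<Sum>e\<in>pairs n. \<Sum>x\<in>{1..n}. pmf Q e * (pmf D y * (pmf D x * v e x y * v e x y)))"
    by (rule sum.cong[OF refl], rule sum.swap)
  also have "\<dots> = (\<Sum>e\<in>pairs n. pmf Q e * pair_norm (v e))"
    unfolding pair_norm_def ip_def sum_distrib_left by (rule sum.swap)
  finally show ?thesis .
qed

text \<open>Cauchy--Schwarz. The sum is the probability that two independent draws coincide, and
  this bound is the source of the factor \<open>1 / n\<close> in the contraction.\<close>

lemma sum_D_squares: "(\<Sum>x\<in>{1..n}. (pmf D x)\<^sup>2) \<ge> 1 / n"
proof -
  have "1 = (\<Sum>x\<in>{1..n}. pmf D x)\<^sup>2" by (simp add: sum_D)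
  also have "\<dots> \<le> (\<Sum>x\<in>{1..n}. (pmf D x)\<^sup>2) * card {1..n}"
    by (rule sum_squared_le_sum_of_squares)
  finally show ?thesis using two_le_n by (simp add: field_simps)
qed

text \<open>Efron--Stein for two independent copies; by symmetry both coordinates contribute the same.\<close>
lemma pair_variance_le:
  assumes sym: "\<And>x y. u x y = u y x"
  defines "g \<equiv> \<lambda>y. ip (\<lambda>x. u x y) (\<lambda>_. 1)"
  shows "pair_norm u - (ip g (\<lambda>_. 1))\<^sup>2 \<le> 2 * (pair_norm u - ip g g)"
proof -
  let ?A = "ip g (\<lambda>_. 1)"
  have g: "g y = (\<Sum>x\<in>{1..n}. pmf D x * u x y)" for y by (simp add: g_def ip_def)
  have g': "g x = (\<Sum>y\<in>{1..n}. pmf D y * u x y)" for x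
    unfolding g by (rule sum.cong) (simp_all add: sym[of x])
  have N: "pair_norm u = (\<Sum>y\<in>{1..n}. pmf D y * (\<Sum>x\<in>{1..n}. pmf D x * (u x y)\<^sup>2))"
    unfolding pair_norm_def ip_def by (simp add: power2_eq_square mult.assoc)
  have A: "?A = (\<Sum>y\<in>{1..n}. pmf D y * g y)" by (simp add: ip_def)
  have G: "ip g g = (\<Sum>y\<in>{1..n}. pmf D y * (g y)\<^sup>2)" by (simp add: ip_def power2_eq_square mult.assoc)
  have "ip g g - ?A\<^sup>2 = (\<Sum>y\<in>{1..n}. pmf D y * (g y - ?A)\<^sup>2)"
  proof -
    have "(\<Sum>y\<in>{1..n}. pmf D y * (g y - ?A)\<^sup>2) =
        (\<Sum>y\<in>{1..n}. pmf D y * (g y)\<^sup>2 - 2 * ?A * (pmf D y * g y) + ?A\<^sup>2 * pmf D y)"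
      by (rule sum.cong) (simp_all add: power2_eq_square algebra_simps)
    also have "\<dots> = ip g g - 2 * ?A * ?A + ?A\<^sup>2 * 1"
      unfolding G sum.distrib sum_subtractf sum_distrib_left[symmetric] A[symmetric] sum_D ..
    finally show ?thesis by (simp add: power2_eq_square)
  qed
  \<comment> \<open>By symmetry \<open>g\<close> averages either coordinate, so
    \<open>g y - ?A\<close> is the mean over \<open>x\<close> of \<open>u x y - g x\<close>. Jensen
    then bounds the variance of \<open>g\<close> by the mean conditional variance
    \<open>pair_norm u - ip g g\<close>.\<close>
  also have "\<dots> = (\<Sum>y\<in>{1..n}. pmf D y * (\<Sum>x\<in>{1..n}. pmf D x * (u x y - g x))\<^sup>2)"
    unfolding A g[of "_ :: nat"] right_diff_distrib sum_subtractf ..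
  also have "\<dots> \<le> (\<Sum>y\<in>{1..n}. pmf D y * (\<Sum>x\<in>{1..n}. pmf D x * (u x y - g x)\<^sup>2))"
    by (intro sum_mono mult_left_mono square_of_weighted_sum_le sum_D) simp_all
  also have "\<dots> = (\<Sum>y\<in>{1..n}. \<Sum>x\<in>{1..n}. pmf D y * (pmf D x * (u x y)\<^sup>2)
      - 2 * (pmf D x * g x * (pmf D y * u x y)) + pmf D x * (g x)\<^sup>2 * pmf D y)"
    unfolding sum_distrib_left
    by (intro sum.cong refl) (simp add: power2_eq_square algebra_simps)
  also have "\<dots> = pair_norm u - 2 * (\<Sum>y\<in>{1..n}. \<Sum>x\<in>{1..n}. pmf D x * g x * (pmf D y * u x y))
      + (\<Sum>y\<in>{1..n}. \<Sum>x\<in>{1..n}. pmf D x * (g x)\<^sup>2 * pmf D y)"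
    unfolding N by (simp add: sum.distrib sum_subtractf sum_distrib_left)
  also have "(\<Sum>y\<in>{1..n}. \<Sum>x\<in>{1..n}. pmf D x * g x * (pmf D y * u x y)) = ip g g"
    unfolding G by (subst sum.swap) (simp add: g'[symmetric] power2_eq_square mult.assoc flip: sum_distrib_left)
  also have "(\<Sum>y\<in>{1..n}. \<Sum>x\<in>{1..n}. pmf D x * (g x)\<^sup>2 * pmf D y) = ip g g"
    unfolding G by (subst sum.swap) (simp add: sum_D flip: sum_distrib_left)
  finally show ?thesis by simp
qed

text \<open>Since \<open>u\<close> vanishes on the diagonal, its mean is its inner product with the
  indicator of the off-diagonal; Cauchy--Schwarz contributes the mass of that set as a factor.
  \<open>r\<close> and \<open>s\<close> carry the square roots of the product weights.\<close>

lemma pair_mean_square_le: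
  assumes diag: "\<And>x. u x x = 0"
  defines "g \<equiv> \<lambda>y. ip (\<lambda>x. u x y) (\<lambda>_. 1)"
  shows "(ip g (\<lambda>_. 1))\<^sup>2 \<le> (1 - 1 / n) * pair_norm u"
proof -
  let ?I = "{1..n} \<times> {1..n}"
  define r where "r z = sqrt (pmf D (fst z) * pmf D (snd z))" for z
  define s where "s z = (if fst z = snd z then 0 else r z)" for z :: "nat \<times> nat"
  have rr: "r z * r z = pmf D (fst z) * pmf D (snd z)" for z
    by (simp add: r_def)
  have "ip g (\<lambda>_. 1) = (\<Sum>z\<in>?I. pmf D (fst z) * pmf D (snd z) * u (snd z) (fst z))"
    unfolding ip_def g_def sum.cartesian_product'[symmetric]
    by (simp add: sum_distrib_left mult.assoc sum.cartesian_product split_def)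
  also have "\<dots> = (\<Sum>z\<in>?I. s z * (r z * u (snd z) (fst z)))"
    by (rule sum.cong) (auto simp: s_def diag rr simp flip: mult.assoc)
  finally have CS: "(ip g (\<lambda>_. 1))\<^sup>2 \<le> (\<Sum>z\<in>?I. (s z)\<^sup>2) * (\<Sum>z\<in>?I. (r z * u (snd z) (fst z))\<^sup>2)"
    using Cauchy_Schwarz_ineq_sum[of s "\<lambda>z. r z * u (snd z) (fst z)" ?I] by simp
  have norm: "(\<Sum>z\<in>?I. (r z * u (snd z) (fst z))\<^sup>2) = pair_norm u"
  proof -
    have "(\<Sum>z\<in>?I. (r z * u (snd z) (fst z))\<^sup>2) =
        (\<Sum>z\<in>?I. pmf D (fst z) * (pmf D (snd z) * u (snd z) (fst z) * u (snd z) (fst z)))"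
      by (rule sum.cong) (simp_all add: power_mult_distrib power2_eq_square[of "r _"] rr, simp add: power2_eq_square mult.assoc)
    then show ?thesis
      unfolding pair_norm_def ip_def by (simp add: sum_distrib_left sum.cartesian_product split_def)
  qed
  have mass: "(\<Sum>z\<in>?I. (s z)\<^sup>2) \<le> 1 - 1 / n"
  proof -
    have "(\<Sum>z\<in>?I. (s z)\<^sup>2) = (\<Sum>x\<in>{1..n}. \<Sum>y\<in>{1..n}. pmf D x * pmf D y - (if y = x then (pmf D x)\<^sup>2 else 0))"
      unfolding sum.cartesian_product
      by (rule sum.cong) (auto simp: s_def rr power2_eq_square split_def)
    also have "\<dots> = (\<Sum>x\<in>{1..n}. pmf D x - (pmf D x)\<^sup>2)"
      by (intro sum.cong refl) (simp add: sum_subtractf sum_D flip: sum_distrib_left)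
    also have "\<dots> = 1 - (\<Sum>x\<in>{1..n}. (pmf D x)\<^sup>2)" by (simp add: sum_subtractf sum_D)
    finally show ?thesis using sum_D_squares by simp
  qed
  have "pair_norm u \<ge> 0"
    unfolding pair_norm_def by (intro sum_nonneg mult_nonneg_nonneg ip_self_nonneg) simp
  then show ?thesis
    using CS mass unfolding norm by (meson mult_right_mono order_trans)
qed

end

context connected_pair_sampling
begin

text \<open>The factor 2 in the energy loss of \<open>pair_norm_pair_avg\<close> is the factor 2 of
  \<open>pair_variance_le\<close>; the variance that remains is at least
  \<open>pair_norm u / n\<close> by \<open>pair_mean_square_le\<close>.\<close>

lemma pair_norm_contraction:
  assumes sym: "\<And>x y. u x y = u y x" and diag: "\<And>x. u x x = 0"
  shows "pair_norm (\<lambda>x y. \<Sum>e\<in>pairs n. pmf Q e * pair_avg e u x y) \<le> (1 - \<Gamma> / n) * pair_norm u"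
proof -
  define g where "g y = ip (\<lambda>x. u x y) (\<lambda>_. 1)" for y
  have "pair_norm (\<lambda>x y. \<Sum>e\<in>pairs n. pmf Q e * pair_avg e u x y)
      \<le> (\<Sum>e\<in>pairs n. pmf Q e * pair_norm (pair_avg e u))"
    by (rule pair_norm_mix)
  also have "\<dots> = (\<Sum>e\<in>pairs n. pmf Q e * pair_norm u
      - 2 * (\<Sum>y\<in>{1..n}. pmf D y * (pmf Q e * energy e (\<lambda>x. u x y))))"
    by (intro sum.cong refl)
      (simp add: pair_norm_pair_avg[OF _ sym diag] right_diff_distrib sum_distrib_left mult_ac)
  also have "\<dots> = pair_norm u - 2 * (\<Sum>y\<in>{1..n}. pmf D y * (\<Sum>e\<in>pairs n. pmf Q e * energy e (\<lambda>x. u x y)))"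
    unfolding sum_subtractf sum_distrib_left[symmetric] sum_distrib_right[symmetric] sum_Q
    by (subst sum.swap) (simp add: sum_distrib_left)
  also have "\<dots> \<le> pair_norm u - 2 * (\<Sum>y\<in>{1..n}. pmf D y * (\<Gamma> * (ip (\<lambda>x. u x y) (\<lambda>x. u x y) - (g y)\<^sup>2)))"
    unfolding g_def by (intro diff_left_mono mult_left_mono sum_mono poincare) simp_all
  also have "\<dots> = pair_norm u - \<Gamma> * (2 * (pair_norm u - ip g g))"
    unfolding pair_norm_def ip_def[of g g]
    by (simp add: algebra_simps sum_subtractf sum_distrib_left power2_eq_square)
  also have "\<dots> \<le> pair_norm u - \<Gamma> * (pair_norm u / n)"
  proof -
    have "pair_norm u / n \<le> pair_norm u - (ip g (\<lambda>_. 1))\<^sup>2"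
      using pair_mean_square_le[of u, OF diag] by (simp add: g_def[abs_def] left_diff_distrib)
    also have "\<dots> \<le> 2 * (pair_norm u - ip g g)"
      using pair_variance_le[of u, OF sym] by (simp add: g_def[abs_def])
    finally show ?thesis using spectral_gap_pos by (intro diff_left_mono mult_left_mono) auto
  qed
  finally show ?thesis by (simp add: left_diff_distrib)
qed

end

section \<open>Random maps and the sampler\<close>

lemma measure_bind_pmf_eq:
  "measure (measure_pmf (bind_pmf p f)) A = (\<integral>x. measure (measure_pmf (f x)) A \<partial>measure_pmf p)"
proof -
  have "ennreal (measure (measure_pmf (bind_pmf p f)) A) = (\<integral>\<^sup>+x. ennreal (measure (measure_pmf (f x)) A) \<partial>measure_pmf p)"
    by (simp add: measure_pmf.emeasure_eq_measure[symmetric])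
  also have "\<dots> = ennreal (\<integral>x. measure (measure_pmf (f x)) A \<partial>measure_pmf p)"
    by (intro nn_integral_eq_integral measure_pmf.integrable_const_bound[where B = 1]) auto
  finally show ?thesis by (simp add: integral_nonneg_AE)
qed

lemma snd_coalescence_test_le: "snd (coalescence_test F xs) \<le> 3 * length xs + 1"
  by (induction xs) (auto split: prod.splits)

lemma snd_update_map: "snd (update_map s F G xs) = 5 * length xs + 1"
  by (induction xs arbitrary: G) (simp_all add: Let_def case_prod_beta)

section \<open>Compositions of random maps and the loop\<close>

context pair_sampling
begin

definition step :: "(nat \<Rightarrow> nat) pmf" where
  "step = bind_pmf Q (\<lambda>e. map_pmf (move e) (cond_pmf D e))"

text \<open>The first map drawn is outermost, as in the sampler, which composes fresh maps on the
  right of \<open>F\<close>.\<close>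

primrec runs :: "nat \<Rightarrow> (nat \<Rightarrow> nat) pmf" where
  "runs 0 = return_pmf (\<lambda>x. x)"
| "runs (Suc k) = bind_pmf step (\<lambda>g. map_pmf (\<lambda>h. g \<circ> h) (runs k))"

definition coalesced :: "(nat \<Rightarrow> nat) \<Rightarrow> bool" where
  "coalesced F \<longleftrightarrow> (\<forall>x\<in>{1..n}. F x = F 1)"

lemma set_Q: "set_pmf Q \<subseteq> pairs n"
  using pair_Q unfolding pair_distribution_def pairs_def .

lemma pairs_subset: "e \<in> pairs n \<Longrightarrow> e \<subseteq> {1..n}"
  unfolding pairs_def by blast

lemma finite_pair: "e \<in> pairs n \<Longrightarrow> finite e"
  using pairs_subset finite_subset by blast

lemma set_cond:
  assumes "e \<in> pairs n"
  shows "set_pmf (cond_pmf D e) = e"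
proof -
  have "set_pmf D \<inter> e = e" "e \<noteq> {}"
    using pairs_subset[OF assms] assms set_D by (auto simp: pairs_def)
  then show ?thesis by (subst set_cond_pmf) auto
qed

lemma pmf_cond_pair:
  assumes "e \<in> pairs n"
  shows "pmf (cond_pmf D e) z = (if z \<in> e then pmf D z / (\<Sum>x\<in>e. pmf D x) else 0)"
proof -
  have "set_pmf D \<inter> e \<noteq> {}"
    using pairs_subset[OF assms] assms set_D by (auto simp: pairs_def)
  then show ?thesis
    by (simp add: pmf_cond measure_measure_pmf_finite finite_pair[OF assms])
qed

text \<open>
  The sampler composes a fresh map on the right of the older ones; the walkers of the coalescence
  estimate need the same law generated in the opposite order.
\<close>
lemma runs_Suc_right: "runs (Suc k) = bind_pmf step (\<lambda>g. map_pmf (\<lambda>h. h \<circ> g) (runs k))"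
proof (induction k)
  case 0
  show ?case by (simp add: comp_def)
next
  case (Suc k)
  have "runs (Suc (Suc k)) = bind_pmf step (\<lambda>g. map_pmf (\<lambda>h. g \<circ> h) (runs (Suc k)))"
    by simp
  also have "\<dots> = bind_pmf step (\<lambda>g. map_pmf (\<lambda>h. g \<circ> h) (bind_pmf step (\<lambda>g'. map_pmf (\<lambda>h. h \<circ> g') (runs k))))"
    unfolding Suc.IH ..
  also have "\<dots> = bind_pmf step (\<lambda>g. bind_pmf step (\<lambda>g'. map_pmf (\<lambda>h. g \<circ> h \<circ> g') (runs k)))"
    by (simp add: map_bind_pmf pmf.map_comp comp_def)
  also have "\<dots> = bind_pmf step (\<lambda>g'. bind_pmf step (\<lambda>g. map_pmf (\<lambda>h. g \<circ> h \<circ> g') (runs k)))"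
    by (rule bind_commute_pmf)
  also have "\<dots> = bind_pmf step (\<lambda>g'. map_pmf (\<lambda>h. h \<circ> g') (runs (Suc k)))"
    by (simp add: map_bind_pmf pmf.map_comp comp_def)
  finally show ?case .
qed

text \<open>The continuation \<open>L\<close> is arbitrary, so the rewriting serves both the
  recursion equation and the fixed-point inductions, where the recursive call is an
  approximation.\<close>

lemma sampler_body:
  fixes L :: "(nat \<Rightarrow> nat) \<Rightarrow> nat \<Rightarrow> nat \<Rightarrow> (nat \<times> nat \<times> nat) spmf"
  shows "(let (b, c) = coalescence_test F [1..<Suc n]
    in if b then return_spmf (F 1, N, T + c + 1)
       else bind_spmf (spmf_of_pmf (samp Q D)) (\<lambda>s.
              let (F', c') = update_map s F F [1..<Suc n] in L F' (N + 1) (T + c + c' + 2))) =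
   (if coalesced F then return_spmf (F 1, N, T + snd (coalescence_test F [1..<Suc n]) + 1)
    else bind_pmf step (\<lambda>g.
      L (F \<circ> g) (N + 1) (T + snd (coalescence_test F [1..<Suc n]) + (5 * n + 1) + 2)))"
proof -
  obtain b c where bc: "coalescence_test F [1..<Suc n] = (b, c)" by fastforce
  have b: "b \<longleftrightarrow> coalesced F"
    using fst_coalescence_test[of n F] two_le_n bc unfolding coalesced_def by auto
  have upd: "update_map (Min e, Max e, z) F F [1..<Suc n] = (F \<circ> move e z, 5 * n + 1)"
    if e: "e \<in> pairs n" and z: "z \<in> e" for e z
  proof -
    obtain x y where xy: "e = {x, y}" "x \<in> {1..n}" "y \<in> {1..n}" "x \<noteq> y"
      using e unfolding pairs_def by blast
    then have "{Min e, Max e} = e" by (auto simp: min_def max_def)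
    then have "fst (update_map (Min e, Max e, z) F F [1..<Suc n]) = F \<circ> move e z"
      unfolding fst_update_map using xy z by (auto simp: fun_eq_iff move_def)
    then show ?thesis using snd_update_map[of "(Min e, Max e, z)" F F "[1..<Suc n]"]
      by (simp add: prod_eq_iff)
  qed
  have body: "bind_spmf (spmf_of_pmf (samp Q D)) (\<lambda>s. let (F', c') = update_map s F F [1..<Suc n] in K F' c') =
      bind_pmf step (\<lambda>g. K (F \<circ> g) (5 * n + 1))" for K :: "(nat \<Rightarrow> nat) \<Rightarrow> nat \<Rightarrow> (nat \<times> nat \<times> nat) spmf"
    unfolding bind_spmf_of_pmf samp_def step_def bind_assoc_pmf bind_map_pmf
    using set_Q by (intro bind_pmf_cong refl) (auto simp: upd set_cond subset_iff simp del: upt_Suc)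
  show ?thesis
    unfolding bc Let_def prod.case snd_conv
    using b body[of "\<lambda>F' c'. L F' (N + 1) (T + c + c' + 2)"] by (simp only: Let_def)
qed

lemma sampler_loop_unfold:
  "sampler_loop n Q D F N T =
   (if coalesced F then return_spmf (F 1, N, T + snd (coalescence_test F [1..<Suc n]) + 1)
    else bind_pmf step (\<lambda>g. sampler_loop n Q D (F \<circ> g) (N + 1)
      (T + snd (coalescence_test F [1..<Suc n]) + (5 * n + 1) + 2)))"
  by (subst sampler_loop.simps) (rule sampler_body)

text \<open>Induction on \<open>k\<close>: a coalesced \<open>F\<close> stops at once with
  \<open>N' = N\<close>, which makes the right side 1; otherwise both sides unfold one fresh map
  \<open>g\<close> and continue from \<open>F \<circ> g\<close>.\<close>

lemma sampler_loop_samples: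
  "emeasure (measure_pmf (runs k)) {h. coalesced (F \<circ> h)} \<le>
    emeasure (measure_spmf (sampler_loop n Q D F N T)) {(x, N', T'). N' \<le> N + k}"
proof (induction k arbitrary: F N T)
  have now: "emeasure (measure_pmf (runs k)) {h. coalesced (F \<circ> h)} \<le>
      emeasure (measure_spmf (sampler_loop n Q D F N T)) {(x, N', T'). N' \<le> N + k}"
    if "coalesced F" for k F N T
  proof -
    have "emeasure (measure_pmf (runs k)) {h. coalesced (F \<circ> h)} \<le> 1"
      by (rule measure_pmf.emeasure_le_1)
    also have "1 \<le> emeasure (measure_spmf (sampler_loop n Q D F N T)) {(x, N', T'). N' \<le> N + k}"
      using that by (subst sampler_loop_unfold) (simp add: emeasure_measure_spmf_conv_measure_pmf)
    finally show ?thesis .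
  qed
  {
    case 0
    then show ?case using now[of F 0] by (cases "coalesced F") (simp_all add: comp_def)
  next
    case (Suc k)
    show ?case
    proof (cases "coalesced F")
      case True
      then show ?thesis by (rule now)
    next
      case False
      have "emeasure (measure_pmf (runs (Suc k))) {h. coalesced (F \<circ> h)} =
          (\<integral>\<^sup>+g. emeasure (measure_pmf (runs k)) {h. coalesced ((F \<circ> g) \<circ> h)} \<partial>measure_pmf step)"
        by (simp add: vimage_def comp_assoc)
      also have "\<dots> \<le> (\<integral>\<^sup>+g. emeasure (measure_spmf (sampler_loop n Q D (F \<circ> g) (N + 1)
          (T + snd (coalescence_test F [1..<Suc n]) + (5 * n + 1) + 2))) {(x, N', T'). N' \<le> N + Suc k} \<partial>measure_pmf step)"
      proof (rule nn_integral_mono)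
        fix g
        have "N + 1 + k = N + Suc k" by simp
        then show "emeasure (measure_pmf (runs k)) {h. coalesced ((F \<circ> g) \<circ> h)} \<le>
            emeasure (measure_spmf (sampler_loop n Q D (F \<circ> g) (N + 1)
              (T + snd (coalescence_test F [1..<Suc n]) + (5 * n + 1) + 2))) {(x, N', T'). N' \<le> N + Suc k}"
          using Suc.IH[of "F \<circ> g" "N + 1"] by metis
      qed
      also have "\<dots> = emeasure (measure_spmf (sampler_loop n Q D F N T)) {(x, N', T'). N' \<le> N + Suc k}"
        using False
        by (subst (2) sampler_loop_unfold) (simp add: emeasure_measure_spmf_conv_measure_pmf del: upt_Suc)
      finally show ?thesis .
    qed
  }
qed

text \<open>A draw from \<open>D\<close> is replaced, if it falls in \<open>e\<close>, by a draw
  conditioned on \<open>e\<close>; this redistributes the mass of \<open>e\<close> in its original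
  proportions.\<close>

lemma stationary_edge:
  assumes e: "e \<in> pairs n"
  shows "bind_pmf (cond_pmf D e) (\<lambda>z. map_pmf (move e z) D) = D"
proof -
  have "bind_pmf (cond_pmf D e) (\<lambda>z. map_pmf (move e z) D) =
      bind_pmf D (\<lambda>x. bind_pmf (cond_pmf D e) (\<lambda>z. return_pmf (move e z x)))"
    unfolding map_pmf_def by (rule bind_commute_pmf)
  also have "\<dots> = bind_pmf D (\<lambda>x. if x \<in> e then cond_pmf D e else return_pmf x)"
    by (intro bind_pmf_cong refl) (auto simp: move_def bind_return_pmf')
  also have "\<dots> = D"
  proof (rule pmf_eqI)
    fix z
    have pos: "(\<Sum>x\<in>e. pmf D x) > 0"
      using finite_pair[OF e] pairs_subset[OF e] D_pos e by (intro sum_pos) (auto simp: pairs_def)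
    have "pmf (bind_pmf D (\<lambda>x. if x \<in> e then cond_pmf D e else return_pmf x)) z =
        (\<Sum>x\<in>{1..n}. pmf (if x \<in> e then cond_pmf D e else return_pmf x) z * pmf D x)"
      unfolding pmf_bind using set_D by (intro integral_measure_pmf_real) auto
    also have "\<dots> = (\<Sum>x\<in>e. pmf (cond_pmf D e) z * pmf D x) + (\<Sum>x\<in>{1..n} - e. if x = z then pmf D z else 0)"
    proof -
      let ?h = "\<lambda>x. pmf (if x \<in> e then cond_pmf D e else return_pmf x) z * pmf D x"
      have "sum ?h {1..n} = sum ?h ({1..n} - e) + sum ?h e"
        using pairs_subset[OF e] by (intro sum.subset_diff) auto
      moreover have "sum ?h e = (\<Sum>x\<in>e. pmf (cond_pmf D e) z * pmf D x)"
        by (rule sum.cong) auto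
      moreover have "sum ?h ({1..n} - e) = (\<Sum>x\<in>{1..n} - e. if x = z then pmf D z else 0)"
        by (rule sum.cong) (auto simp: indicator_def)
      ultimately show ?thesis by simp
    qed
    also have "\<dots> = (if z \<in> e then pmf D z else 0) + (if z \<in> {1..n} - e then pmf D z else 0)"
      using pos by (simp add: pmf_cond_pair[OF e] flip: sum_distrib_left)
    also have "\<dots> = pmf D z"
      using pairs_subset[OF e] set_D by (auto simp: set_pmf_iff)
    finally show "pmf (bind_pmf D (\<lambda>x. if x \<in> e then cond_pmf D e else return_pmf x)) z = pmf D z" .
  qed
  finally show ?thesis .
qed

lemma stationary: "bind_pmf step (\<lambda>g. map_pmf (F \<circ> g) D) = map_pmf F D"
proof -
  have "bind_pmf step (\<lambda>g. map_pmf (F \<circ> g) D) =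
      bind_pmf Q (\<lambda>e. map_pmf F (bind_pmf (cond_pmf D e) (\<lambda>z. map_pmf (move e z) D)))"
    unfolding step_def by (simp add: bind_assoc_pmf bind_map_pmf map_bind_pmf pmf.map_comp)
  also have "\<dots> = bind_pmf Q (\<lambda>e. map_pmf F D)"
    using set_Q by (intro bind_pmf_cong refl) (auto simp: stationary_edge)
  finally show ?thesis by simp
qed

text \<open>Fixed-point induction gives domination only, since unfinished runs are missing mass. At
  coalescence the image of \<open>D\<close> under \<open>F\<close> is the point mass at
  \<open>F 1\<close>; before that, \<open>stationary\<close> preserves it on average.\<close>

lemma sampler_loop_output_le:
  "ord_spmf (=) (map_spmf fst (sampler_loop n Q D F N T)) (spmf_of_pmf (map_pmf F D))"
proof -
  define P where "P L \<longleftrightarrow> (\<forall>F N T. ord_spmf (=) (map_spmf fst (L n Q D F N T)) (spmf_of_pmf (map_pmf F D)))"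
    for L :: "nat \<Rightarrow> nat set pmf \<Rightarrow> nat pmf \<Rightarrow> (nat \<Rightarrow> nat) \<Rightarrow> nat \<Rightarrow> nat \<Rightarrow> (nat \<times> nat \<times> nat) spmf"
  have "P sampler_loop"
  proof (induction rule: sampler_loop.fixp_induct)
    case 1
    show ?case unfolding P_def by simp
  next
    case 2
    show ?case unfolding P_def by simp
  next
    case (3 L)
    show ?case unfolding P_def
    proof (intro allI)
      fix F N T
      show "ord_spmf (=) (map_spmf fst (let (b, c) = coalescence_test F [1..<Suc n]
        in if b then return_spmf (F 1, N, T + c + 1)
         else bind_spmf (spmf_of_pmf (samp Q D)) (\<lambda>s.
              let (F', c') = update_map s F F [1..<Suc n] in L n Q D F' (N + 1) (T + c + c' + 2))))
         (spmf_of_pmf (map_pmf F D))"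
        unfolding sampler_body
      proof (cases "coalesced F")
        case True
        have "map_pmf F D = map_pmf (\<lambda>_. F 1) D"
          by (rule map_pmf_cong[OF refl]) (use True set_D in \<open>unfold coalesced_def, blast\<close>)
        with True show "ord_spmf (=) (map_spmf fst (if coalesced F
            then return_spmf (F 1, N, T + snd (coalescence_test F [1..<Suc n]) + 1)
            else bind_pmf step (\<lambda>g. L n Q D (F \<circ> g) (N + 1)
              (T + snd (coalescence_test F [1..<Suc n]) + (5 * n + 1) + 2)))) (spmf_of_pmf (map_pmf F D))"
          by simp
      next
        case False
        have "ord_spmf (=) (bind_spmf (spmf_of_pmf step) (\<lambda>g. map_spmf fst (L n Q D (F \<circ> g) (N + 1)
              (T + snd (coalescence_test F [1..<Suc n]) + (5 * n + 1) + 2))))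
            (bind_spmf (spmf_of_pmf step) (\<lambda>g. spmf_of_pmf (map_pmf (F \<circ> g) D)))"
          using 3 unfolding P_def by (intro bind_spmf_mono') (auto simp del: upt_Suc)
        also have "bind_spmf (spmf_of_pmf step) (\<lambda>g. spmf_of_pmf (map_pmf (F \<circ> g) D)) =
            spmf_of_pmf (bind_pmf step (\<lambda>g. map_pmf (F \<circ> g) D))"
          by (simp add: bind_spmf_of_pmf spmf_of_pmf_bind)
        also have "\<dots> = spmf_of_pmf (map_pmf F D)" by (simp only: stationary)
        finally show "ord_spmf (=) (map_spmf fst (if coalesced F
            then return_spmf (F 1, N, T + snd (coalescence_test F [1..<Suc n]) + 1)
            else bind_pmf step (\<lambda>g. L n Q D (F \<circ> g) (N + 1)
              (T + snd (coalescence_test F [1..<Suc n]) + (5 * n + 1) + 2)))) (spmf_of_pmf (map_pmf F D))"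
          using False by (simp add: map_spmf_bind_spmf o_def flip: bind_spmf_of_pmf del: upt_Suc)
      qed
    qed
  qed
  then show ?thesis unfolding P_def by blast
qed

text \<open>Only the loser \<open>c\<close> of the pair is moved, so at most the value
  \<open>F c\<close> disappears.\<close>

lemma card_image_move:
  assumes e: "e \<in> pairs n" and z: "z \<in> e"
  shows "card (F ` {1..n}) \<le> Suc (card ((F \<circ> move e z) ` {1..n}))"
proof -
  obtain a b where ab: "e = {a, b}" "a \<in> {1..n}" "b \<in> {1..n}" "a \<noteq> b"
    using e unfolding pairs_def by blast
  define c where "c = (if z = a then b else a)"
  have "F x \<in> insert (F c) ((F \<circ> move e z) ` {1..n})" if "x \<in> {1..n}" for x
  proof (cases "x = c")
    case False
    then have "move e z x = x" using ab z by (auto simp: move_def c_def)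
    then have "F x = (F \<circ> move e z) x" by simp
    then show ?thesis using that by blast
  qed simp
  then have "F ` {1..n} \<subseteq> insert (F c) ((F \<circ> move e z) ` {1..n})" by blast
  then have "card (F ` {1..n}) \<le> card (insert (F c) ((F \<circ> move e z) ` {1..n}))"
    by (intro card_mono) auto
  also have "\<dots> \<le> Suc (card ((F \<circ> move e z) ` {1..n}))" by (rule card_insert_le_m1) auto
  finally show ?thesis .
qed

text \<open>
  Each sample removes at most one point from the image of the map, so at least \<open>n - 1\<close> samples
  are drawn; this is what bounds the \<open>O(n)\<close> cost of an iteration in terms of \<open>N\<close>.
\<close>
lemma sampler_loop_time:
  "set_spmf (sampler_loop n Q D F N T) \<subseteq>
    {(x, N', T'). card (F ` {1..n}) + N \<le> N' + 1 \<and> T' + N * (8 * n + 4) \<le> T + N' * (8 * n + 4) + (3 * n + 2)}"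
proof -
  \<comment> \<open>The cost of an iteration: at most \<open>3 * n + 1\<close> for the test,
    \<open>5 * n + 1\<close> for the update and 2 for the rest. The final test and output add
    \<open>3 * n + 2\<close>. Keeping \<open>N * K\<close> on the left in \<open>B\<close> avoids
    truncated subtraction.\<close>
  define K where "K = 8 * n + 4"
  define B where "B F N T = {(x :: nat, N', T'). card (F ` {1..n}) + N \<le> N' + 1 \<and>
      T' + N * K \<le> T + N' * K + (3 * n + 2)}"
    for F :: "nat \<Rightarrow> nat" and N T :: nat
  define P where "P L \<longleftrightarrow> (\<forall>F N T. set_spmf (L n Q D F N T) \<subseteq> B F N T)"
    for L :: "nat \<Rightarrow> nat set pmf \<Rightarrow> nat pmf \<Rightarrow> (nat \<Rightarrow> nat) \<Rightarrow> nat \<Rightarrow> nat \<Rightarrow> (nat \<times> nat \<times> nat) spmf"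
  have "P sampler_loop"
  proof (induction rule: sampler_loop.fixp_induct)
    case 1
    show ?case unfolding P_def by simp
  next
    case 2
    show ?case unfolding P_def by simp
  next
    case (3 L)
    have IH: "set_spmf (L n Q D F N T) \<subseteq> B F N T" for F N T
      using 3 unfolding P_def by (elim allE)
    have "set_spmf (if coalesced F then return_spmf (F 1, N, T + snd (coalescence_test F [1..<Suc n]) + 1)
        else bind_pmf step (\<lambda>g. L n Q D (F \<circ> g) (N + 1)
          (T + snd (coalescence_test F [1..<Suc n]) + (5 * n + 1) + 2))) \<subseteq> B F N T" for F N T
    proof -
      define c where "c = snd (coalescence_test F [1..<Suc n])"
      have c: "c \<le> 3 * n + 1"
        using snd_coalescence_test_le[of F "[1..<Suc n]"] by (simp add: c_def del: upt_Suc)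
      show ?thesis
        unfolding c_def[symmetric]
      proof (cases "coalesced F")
        case True
        then have "F ` {1..n} \<subseteq> {F 1}" unfolding coalesced_def by blast
        then have "card (F ` {1..n}) \<le> card {F 1}" by (intro card_mono) auto
        then have "(F 1, N, T + c + 1) \<in> B F N T"
          using c by (simp add: B_def)
        with True show "set_spmf (if coalesced F then return_spmf (F 1, N, T + c + 1)
            else bind_pmf step (\<lambda>g. L n Q D (F \<circ> g) (N + 1) (T + c + (5 * n + 1) + 2))) \<subseteq> B F N T"
          by simp
      next
        case False
        have "r \<in> B F N T" if g: "g \<in> set_pmf step" and
            r: "r \<in> set_spmf (L n Q D (F \<circ> g) (N + 1) (T + c + (5 * n + 1) + 2))" for g r
        proof -
          obtain e z where "e \<in> set_pmf Q" "z \<in> set_pmf (cond_pmf D e)" and gez: "g = move e z"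
            using g unfolding step_def by auto
          then have "e \<in> pairs n" "z \<in> e" using set_Q set_cond by auto
          then have card: "card (F ` {1..n}) \<le> Suc (card ((F \<circ> g) ` {1..n}))"
            unfolding gez by (rule card_image_move)
          obtain x N' T' where r': "r = (x, N', T')" by (cases r)
          have "(x, N', T') \<in> B (F \<circ> g) (N + 1) (T + c + (5 * n + 1) + 2)"
            using subsetD[OF IH r] unfolding r' .
          then have "card ((F \<circ> g) ` {1..n}) + (N + 1) \<le> N' + 1"
            "T' + (N * K + K) \<le> (T + c + (5 * n + 1) + 2) + N' * K + (3 * n + 2)"
            unfolding B_def by (simp_all add: add_mult_distrib)
          then show ?thesis using c card unfolding r' B_def K_def by simp
        qed
        with False show "set_spmf (if coalesced F then return_spmf (F 1, N, T + c + 1)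
            else bind_pmf step (\<lambda>g. L n Q D (F \<circ> g) (N + 1) (T + c + (5 * n + 1) + 2))) \<subseteq> B F N T"
          by (auto simp: set_spmf_bind_pmf)
      qed
    qed
    then show ?case unfolding P_def sampler_body by blast
  qed
  then show ?thesis unfolding P_def B_def K_def by blast
qed

end

section \<open>Coalescence\<close>

context pair_sampling
begin

definition disagree :: "nat \<Rightarrow> nat \<Rightarrow> nat \<Rightarrow> real" where
  "disagree k x y = measure (measure_pmf (runs k)) {h. h x \<noteq> h y}"

lemma disagree_commute: "disagree k x y = disagree k y x"
  unfolding disagree_def by (simp add: eq_commute)

lemma disagree_refl: "disagree k x x = 0"
  by (simp add: disagree_def)

text \<open>Decomposes on the map that acts first on the points, as \<open>runs_Suc_right\<close>
  allows; conditioning on its pair and winner gives the common-winner average.\<close>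

lemma disagree_Suc:
  "disagree (Suc k) x y = (\<Sum>e\<in>pairs n. pmf Q e * pair_avg e (disagree k) x y)"
proof -
  have inner: "measure (measure_pmf (bind_pmf (cond_pmf D e) (\<lambda>z. map_pmf (\<lambda>h. h \<circ> move e z) (runs k)))) {h. h x \<noteq> h y}
      = pair_avg e (disagree k) x y" if e: "e \<in> pairs n" for e
  proof -
    have "measure (measure_pmf (bind_pmf (cond_pmf D e) (\<lambda>z. map_pmf (\<lambda>h. h \<circ> move e z) (runs k)))) {h. h x \<noteq> h y}
        = (\<integral>z. disagree k (move e z x) (move e z y) \<partial>measure_pmf (cond_pmf D e))"
      unfolding measure_bind_pmf_eq by (simp add: disagree_def vimage_def)
    also have "\<dots> = (\<Sum>z\<in>e. disagree k (move e z x) (move e z y) * pmf (cond_pmf D e) z)"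
      using set_cond[OF e] by (intro integral_measure_pmf_real finite_pair[OF e]) auto
    also have "\<dots> = pair_avg e (disagree k) x y"
      unfolding pair_avg_def sum_divide_distrib
      by (rule sum.cong) (simp_all add: pmf_cond_pair[OF e])
    finally show ?thesis .
  qed
  have "runs (Suc k) = bind_pmf Q (\<lambda>e. bind_pmf (cond_pmf D e) (\<lambda>z. map_pmf (\<lambda>h. h \<circ> move e z) (runs k)))"
    unfolding runs_Suc_right step_def by (simp add: bind_assoc_pmf bind_map_pmf)
  then have "disagree (Suc k) x y = (\<Sum>e\<in>pairs n.
      measure (measure_pmf (bind_pmf (cond_pmf D e) (\<lambda>z. map_pmf (\<lambda>h. h \<circ> move e z) (runs k)))) {h. h x \<noteq> h y} * pmf Q e)"
    unfolding disagree_def using set_Q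
    by (simp only: measure_bind_pmf_eq[of Q]) (intro integral_measure_pmf_real finite_pairs, auto)
  then show ?thesis by (simp add: inner mult.commute)
qed

definition D_min :: real where "D_min = Min (pmf D ` {1..n})"

lemma D_min_le: "x \<in> {1..n} \<Longrightarrow> D_min \<le> pmf D x"
  unfolding D_min_def by (intro Min_le) auto

lemma D_min_pos: "D_min > 0"
  unfolding D_min_def using two_le_n D_pos by (subst Min_gr_iff) auto

text \<open>Turns the factor \<open>n\<close> of the union bound into another
  \<open>1 / D_min\<close>.\<close>

lemma n_mult_D_min_le: "n * D_min \<le> 1"
proof -
  have "(\<Sum>x\<in>{1..n}. D_min) \<le> (\<Sum>x\<in>{1..n}. pmf D x)"
    by (intro sum_mono D_min_le)
  then show ?thesis by (simp add: sum_D)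
qed

end

section \<open>Tail bound, termination, exactness and running time\<close>

context connected_pair_sampling
begin

lemma pair_norm_disagree: "pair_norm (disagree k) \<le> (1 - \<Gamma> / n) ^ k"
proof (induction k)
  case 0
  have "pair_norm (disagree 0) \<le> (\<Sum>y\<in>{1..n}. pmf D y * (\<Sum>x\<in>{1..n}. pmf D x * 1))"
    unfolding pair_norm_def ip_def mult.assoc
    by (intro sum_mono mult_left_mono) (auto simp: disagree_def indicator_def)
  then show ?case by (simp add: sum_D)
next
  case (Suc k)
  have "\<Gamma> / n \<le> 1" using spectral_gap_le_1 two_le_n by (simp add: field_simps)
  have "pair_norm (disagree (Suc k)) \<le> (1 - \<Gamma> / n) * pair_norm (disagree k)"
    unfolding disagree_Suc[abs_def] by (rule pair_norm_contraction[OF disagree_commute disagree_refl])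
  also have "\<dots> \<le> (1 - \<Gamma> / n) * (1 - \<Gamma> / n) ^ k"
    using \<open>\<Gamma> / n \<le> 1\<close> Suc.IH by (intro mult_left_mono) auto
  finally show ?case by simp
qed

text \<open>A single term of \<open>pair_norm\<close> carries weight at least the square of
  \<open>D_min\<close>; the square root then halves the exponent.\<close>

lemma disagree_le:
  assumes x: "x \<in> {1..n}" and y: "y \<in> {1..n}"
  shows "D_min * disagree k x y \<le> exp (- \<Gamma> * k / (2 * n))"
proof (rule power2_le_imp_le)
  let ?u = "disagree k"
  have "(D_min * ?u x y)\<^sup>2 = D_min * (D_min * (?u x y)\<^sup>2)" by (simp add: power2_eq_square mult_ac)
  also have "\<dots> \<le> pmf D y * (pmf D x * (?u x y)\<^sup>2)"
    using D_min_pos by (intro mult_mono D_min_le x y) auto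
  also have "\<dots> \<le> pmf D y * ip (\<lambda>x. ?u x y) (\<lambda>x. ?u x y)"
    unfolding ip_def using x
    by (intro mult_left_mono order_trans[OF _ member_le_sum[of x]]) (auto simp: power2_eq_square mult.assoc)
  also have "\<dots> \<le> pair_norm ?u"
    unfolding pair_norm_def using y
    by (intro member_le_sum[of y "{1..n}" "\<lambda>y. pmf D y * ip (\<lambda>x. ?u x y) (\<lambda>x. ?u x y)"]) (auto simp: ip_self_nonneg)
  also have "\<dots> \<le> (1 - \<Gamma> / n) ^ k" by (rule pair_norm_disagree)
  also have "\<dots> \<le> exp (- \<Gamma> / n) ^ k"
  proof (rule power_mono)
    show "1 - \<Gamma> / n \<le> exp (- \<Gamma> / n)" using exp_ge_add_one_self[of "- \<Gamma> / n"] by simp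
    show "0 \<le> 1 - \<Gamma> / n" using spectral_gap_le_1 two_le_n by (simp add: field_simps)
  qed
  also have "\<dots> = (exp (- \<Gamma> * k / (2 * n)))\<^sup>2"
    by (simp add: exp_of_nat_mult[symmetric] power2_eq_square exp_add[symmetric] field_simps)
  finally show "(D_min * ?u x y)\<^sup>2 \<le> (exp (- \<Gamma> * k / (2 * n)))\<^sup>2" .
qed simp

text \<open>Union bound over the events that \<open>x\<close> and the point 1 are separated. Its
  factor \<open>n / D_min\<close> is at most the square of \<open>1 / D_min\<close>, whence the 2 in
  the exponent.\<close>

lemma prob_coalesced_ge:
  "measure (measure_pmf (runs k)) {h. coalesced h} \<ge> 1 - exp (2 * ln (1 / D_min) - \<Gamma> * k / (2 * n))"
proof -
  have "1 - measure (measure_pmf (runs k)) {h. coalesced h} = measure (measure_pmf (runs k)) (- {h. coalesced h})"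
    using measure_pmf.prob_compl[of "{h. coalesced h}" "runs k"] by (simp add: Compl_eq_Diff_UNIV)
  also have "- {h. coalesced h} = (\<Union>x\<in>{1..n}. {h. h x \<noteq> h 1})"
    unfolding coalesced_def by blast
  also have "measure (measure_pmf (runs k)) \<dots> \<le> (\<Sum>x\<in>{1..n}. disagree k x 1)"
    unfolding disagree_def by (intro measure_pmf.finite_measure_subadditive_finite) auto
  also have "\<dots> \<le> (\<Sum>x\<in>{1..n}. exp (- \<Gamma> * k / (2 * n)) / D_min)"
    using disagree_le[of _ 1 k] two_le_n D_min_pos by (intro sum_mono) (simp add: field_simps)
  also have "\<dots> = n * (exp (- \<Gamma> * k / (2 * n)) / D_min)" by simp
  also have "\<dots> \<le> (1 / D_min) * (exp (- \<Gamma> * k / (2 * n)) / D_min)"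
    using n_mult_D_min_le D_min_pos by (intro mult_right_mono) (simp_all add: field_simps)
  also have "\<dots> = exp (ln (1 / D_min)) * exp (ln (1 / D_min)) * exp (- \<Gamma> * k / (2 * n))"
    using D_min_pos by simp
  also have "\<dots> = exp (2 * ln (1 / D_min) - \<Gamma> * k / (2 * n))"
    unfolding exp_add[symmetric] by simp
  finally show ?thesis by simp
qed

text \<open>The constants 4 and 6 make \<open>\<Gamma> * B / (2 * n)\<close> equal to
  \<open>2 * L * l + 3 * L * (l / l0)\<close>. As \<open>L \<ge> 1 / 2\<close>, the first term
  covers \<open>l\<close>; as \<open>l \<ge> l0\<close>, the second covers \<open>2 * L\<close> plus
  1/2 for rounding.\<close>

lemma exact_sampler_samples:
  assumes \<delta>: "0 < \<delta>" "\<delta> \<le> \<delta>0" "\<delta>0 < 1"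
  defines "B \<equiv> (4 + 6 / ln (1 / \<delta>0)) * (n * ln (1 / D_min) / \<Gamma> * ln (1 / \<delta>))"
  shows "measure (measure_spmf (exact_sampler n Q D)) {(x, N, T). real N \<le> B} \<ge> 1 - \<delta>"
proof -
  define l where "l = ln (1 / \<delta>)"
  define l0 where "l0 = ln (1 / \<delta>0)"
  define L where "L = ln (1 / D_min)"
  have l0: "l0 > 0" using \<delta> by (simp add: l0_def)
  have l: "l \<ge> l0" unfolding l_def l0_def using \<delta> by (subst ln_le_cancel_iff) (auto simp: field_simps)
  have L: "L \<ge> 1 / 2"
  proof -
    have "D_min * 2 \<le> D_min * n" using two_le_n D_min_pos by (intro mult_left_mono) auto
    then have "D_min * 2 \<le> 1" using n_mult_D_min_le by (simp add: mult.commute)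
    then have "ln 2 \<le> L" unfolding L_def using D_min_pos by (subst ln_le_cancel_iff) (auto simp: field_simps)
    moreover have "(1 :: real) / 2 \<le> ln 2" using ln2_ge_two_thirds by simp
    ultimately show ?thesis by simp
  qed
  have B: "B = (4 + 6 / l0) * (n * L / \<Gamma> * l)" by (simp add: B_def l_def l0_def L_def)
  have B0: "B \<ge> 0" unfolding B using l0 l L spectral_gap_pos by (intro mult_nonneg_nonneg divide_nonneg_pos add_nonneg_nonneg) auto
  \<comment> \<open>Sample counts are integers, so \<open>B\<close> is rounded down; as the gap is
    at most 1, this costs at most 1/2 in the exponent.\<close>
  define k where "k = nat \<lfloor>B\<rfloor>"
  have k: "real k \<le> B" "B - 1 \<le> real k" unfolding k_def using B0 by linarith+
  have "\<Gamma> * B / (2 * n) - 1 / 2 \<le> \<Gamma> * k / (2 * n)"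
  proof -
    have "\<Gamma> * B / (2 * n) - \<Gamma> / (2 * n) = \<Gamma> * (B - 1) / (2 * n)"
      by (simp add: right_diff_distrib diff_divide_distrib)
    also have "\<dots> \<le> \<Gamma> * k / (2 * n)"
      using k(2) spectral_gap_pos by (intro divide_right_mono mult_left_mono) auto
    finally have "\<Gamma> * B / (2 * n) - \<Gamma> / (2 * n) \<le> \<Gamma> * k / (2 * n)" .
    moreover have "\<Gamma> / (2 * n) \<le> 1 / 2"
      using spectral_gap_le_1 two_le_n by (simp add: field_simps)
    ultimately show ?thesis by linarith
  qed
  moreover have "\<Gamma> * B / (2 * n) = 2 * L * l + 3 * L * (l / l0)"
    unfolding B using spectral_gap_pos two_le_n by (simp add: field_simps)
  moreover have "l \<le> 2 * L * l" using L l l0 mult_right_mono[of 1 "2 * L" l] by simp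
  moreover have "3 * L \<le> 3 * L * (l / l0)"
    using L l l0 mult_left_mono[of 1 "l / l0" "3 * L"] by (simp add: field_simps)
  ultimately have "2 * L - \<Gamma> * k / (2 * n) \<le> - l" using L by linarith
  then have "exp (2 * L - \<Gamma> * k / (2 * n)) \<le> exp (- l)" by simp
  also have "exp (- l) = \<delta>" unfolding l_def using \<delta> by (simp add: ln_div)
  finally have "1 - \<delta> \<le> measure (measure_pmf (runs k)) {h. coalesced h}"
    using prob_coalesced_ge[of k] by (simp add: L_def)
  also have "\<dots> \<le> measure (measure_spmf (exact_sampler n Q D)) {(x, N, T). N \<le> k}"
    using sampler_loop_samples[of k "\<lambda>x. x" 0 "n + 1"]
    by (simp add: exact_sampler_def comp_def measure_pmf.emeasure_eq_measure measure_spmf.emeasure_eq_measure)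
  also have "\<dots> \<le> measure (measure_spmf (exact_sampler n Q D)) {(x, N, T). real N \<le> B}"
    using k(1) by (intro measure_spmf.finite_measure_mono) auto
  finally show ?thesis .
qed

text \<open>With the cap fixed at 1/2, the sample bound holds for arbitrarily small failure
  probabilities, so the terminating mass is 1.\<close>

lemma exact_sampler_lossless: "lossless_spmf (exact_sampler n Q D)"
proof -
  have "1 \<le> weight_spmf (exact_sampler n Q D)"
  proof (rule field_le_epsilon)
    fix \<epsilon> :: real assume "\<epsilon> > 0"
    define \<delta> where "\<delta> = min \<epsilon> (1 / 2)"
    have \<delta>: "0 < \<delta>" "\<delta> \<le> 1 / 2" "\<delta> \<le> \<epsilon>" using \<open>\<epsilon> > 0\<close> by (auto simp: \<delta>_def)
    let ?S = "{(x, N, T). real N \<le> (4 + 6 / ln (1 / (1 / 2 :: real))) * (n * ln (1 / D_min) / \<Gamma> * ln (1 / \<delta>))}"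
    have "1 - \<delta> \<le> measure (measure_spmf (exact_sampler n Q D)) ?S"
      by (rule exact_sampler_samples) (use \<delta> in auto)
    also have "\<dots> \<le> weight_spmf (exact_sampler n Q D)"
      unfolding weight_spmf_def by (intro measure_spmf.finite_measure_mono) auto
    finally show "1 \<le> weight_spmf (exact_sampler n Q D) + \<epsilon>" using \<delta>(3) by simp
  qed
  then show ?thesis unfolding lossless_spmf_def using weight_spmf_le_1 antisym by blast
qed

text \<open>Domination by \<open>D\<close> together with total mass 1 forces equality.\<close>

lemma exact_sampler_output: "map_spmf fst (exact_sampler n Q D) = spmf_of_pmf D"
proof -
  have le: "ord_spmf (=) (map_spmf fst (exact_sampler n Q D)) (spmf_of_pmf D)"
    using sampler_loop_output_le[of "\<lambda>x. x" 0 "n + 1"] by (simp add: exact_sampler_def)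
  have "pmf (map_spmf fst (exact_sampler n Q D)) None = pmf (spmf_of_pmf D) None"
    using exact_sampler_lossless
    by (metis lossless_iff_pmf_None lossless_map_spmf lossless_spmf_spmf_of_spmf)
  from ord_spmf_eq_pmf_None_eq[OF chain_empty le this] show ?thesis .
qed

text \<open>The identity map has image of size \<open>n\<close>, so \<open>n \<le> N + 1\<close>;
  substituting this for \<open>n\<close> in the time bound yields the polynomial.\<close>

lemma exact_sampler_time:
  assumes "(x, N, T) \<in> set_spmf (exact_sampler n Q D)"
  shows "T \<le> poly [:7, 16, 8:] N"
proof -
  have *: "n \<le> N + 1" "T \<le> n + 1 + N * (8 * n + 4) + (3 * n + 2)"
    using subsetD[OF sampler_loop_time assms[unfolded exact_sampler_def]] by auto
  have "N * (8 * n + 4) \<le> N * (8 * (N + 1) + 4)" using *(1) by (intro mult_left_mono) auto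
  then have "T \<le> 8 * (N * N) + 16 * N + 7" using * by (simp add: algebra_simps)
  then show ?thesis by (simp add: algebra_simps)
qed

end

text \<open>The polynomial is chosen before everything else, and \<open>C\<close> depends only on
  the cap \<open>\<delta>\<^sub>0\<close>. The cap keeps \<open>ln (1 / \<delta>)\<close> away from
  0, which matters because a run always draws at least one sample.\<close>

theorem theorem2:
  shows "\<exists>p :: nat poly. \<forall>\<delta>\<^sub>0 :: real. 0 < \<delta>\<^sub>0 \<and> \<delta>\<^sub>0 < 1 \<longrightarrow>
    (\<exists>C :: real. C > 0 \<and>
      (\<forall>(n :: nat) (D :: nat pmf) (Q :: nat set pmf).
        set_pmf D = {1..n} \<and> pair_distribution n Q \<and>
        Digraph_Component.connected (with_proj (induced_graph n Q)) \<longrightarrow>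
          (\<forall>\<delta> :: real. 0 < \<delta> \<and> \<delta> \<le> \<delta>\<^sub>0 \<longrightarrow>
             measure (measure_spmf (exact_sampler n Q D))
               {(x, N, T). real N \<le>
                  C * (real n * ln (1 / Min (pmf D ` {1..n}))
                         / absolute_spectral_gap (canonical_matrix n Q D) * ln (1 / \<delta>))}
             \<ge> 1 - \<delta>) \<and>
          (\<forall>(x, N, T) \<in> set_spmf (exact_sampler n Q D). T \<le> poly p N) \<and>
          map_spmf fst (exact_sampler n Q D) = spmf_of_pmf D))"
proof (intro exI[of _ "[:7, 16, 8:]"] allI impI, elim conjE)
  fix \<delta>\<^sub>0 :: real
  assume \<delta>\<^sub>0: "0 < \<delta>\<^sub>0" "\<delta>\<^sub>0 < 1"
  let ?C = "4 + 6 / ln (1 / \<delta>\<^sub>0)"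
  show "\<exists>C :: real. C > 0 \<and>
      (\<forall>(n :: nat) (D :: nat pmf) (Q :: nat set pmf).
        set_pmf D = {1..n} \<and> pair_distribution n Q \<and>
        Digraph_Component.connected (with_proj (induced_graph n Q)) \<longrightarrow>
          (\<forall>\<delta> :: real. 0 < \<delta> \<and> \<delta> \<le> \<delta>\<^sub>0 \<longrightarrow>
             measure (measure_spmf (exact_sampler n Q D))
               {(x, N, T). real N \<le>
                  C * (real n * ln (1 / Min (pmf D ` {1..n}))
                         / absolute_spectral_gap (canonical_matrix n Q D) * ln (1 / \<delta>))}
             \<ge> 1 - \<delta>) \<and>
          (\<forall>(x, N, T) \<in> set_spmf (exact_sampler n Q D). T \<le> poly [:7, 16, 8:] N) \<and>
          map_spmf fst (exact_sampler n Q D) = spmf_of_pmf D)"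
  proof (rule exI[of _ ?C], rule conjI)
    show "?C > 0" using \<delta>\<^sub>0 by (intro add_pos_pos divide_pos_pos) auto
    show "\<forall>(n :: nat) (D :: nat pmf) (Q :: nat set pmf).
        set_pmf D = {1..n} \<and> pair_distribution n Q \<and>
        Digraph_Component.connected (with_proj (induced_graph n Q)) \<longrightarrow>
          (\<forall>\<delta> :: real. 0 < \<delta> \<and> \<delta> \<le> \<delta>\<^sub>0 \<longrightarrow>
             measure (measure_spmf (exact_sampler n Q D))
               {(x, N, T). real N \<le>
                  ?C * (real n * ln (1 / Min (pmf D ` {1..n}))
                         / absolute_spectral_gap (canonical_matrix n Q D) * ln (1 / \<delta>))}
             \<ge> 1 - \<delta>) \<and>
          (\<forall>(x, N, T) \<in> set_spmf (exact_sampler n Q D). T \<le> poly [:7, 16, 8:] N) \<and>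
          map_spmf fst (exact_sampler n Q D) = spmf_of_pmf D"
    proof (intro allI impI, elim conjE)
      fix n :: nat and D :: "nat pmf" and Q :: "nat set pmf"
      assume "set_pmf D = {1..n}" "pair_distribution n Q"
        "Digraph_Component.connected (with_proj (induced_graph n Q))"
      then interpret connected_pair_sampling n D Q by unfold_locales
      show "(\<forall>\<delta> :: real. 0 < \<delta> \<and> \<delta> \<le> \<delta>\<^sub>0 \<longrightarrow>
             measure (measure_spmf (exact_sampler n Q D))
               {(x, N, T). real N \<le>
                  ?C * (real n * ln (1 / Min (pmf D ` {1..n})) / \<Gamma> * ln (1 / \<delta>))}
             \<ge> 1 - \<delta>) \<and>
          (\<forall>(x, N, T) \<in> set_spmf (exact_sampler n Q D). T \<le> poly [:7, 16, 8:] N) \<and>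
          map_spmf fst (exact_sampler n Q D) = spmf_of_pmf D"
      proof (intro conjI allI impI ballI exact_sampler_output, elim conjE)
        show "1 - \<delta> \<le> measure (measure_spmf (exact_sampler n Q D))
            {(x, N, T). real N \<le> ?C * (real n * ln (1 / Min (pmf D ` {1..n})) / \<Gamma> * ln (1 / \<delta>))}"
          if "0 < \<delta>" "\<delta> \<le> \<delta>\<^sub>0" for \<delta>
          using exact_sampler_samples[OF that \<delta>\<^sub>0(2)] unfolding D_min_def .
        show "case r of (x, N, T) \<Rightarrow> T \<le> poly [:7, 16, 8:] N"
          if "r \<in> set_spmf (exact_sampler n Q D)" for r
          using that exact_sampler_time by (cases r) (simp only: prod.case)
      qed
    qed
  qed
qed

end
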